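(* Let $T>0$, $d\ge 1$, and let $F,m:[0,T]\times\mathbb{R}^d\to\mathbb{R}^d$ and $\sigma:[0,T]\times\mathbb{R}^d\to\mathbb{R}^{d\times d}$ satisfy the following: with $a:=\sigma\sigma^*$ ($\sigma^*$ the transpose of $\sigma$), there is $\Lambda\ge 1$ such that $\Lambda^{-1}|\xi|^2\le\langle a(t,x)\xi,\xi\rangle\le\Lambda|\xi|^2$ for all $(t,x,\xi)\in[0,T]\times(\mathbb{R}^d)^2$; $F$ is two times continuously differentiable in $[0,T]\times\mathbb{R}^d$, and there is a finite constant $M_F$ such that $\max_{t\in[0,T]}\|D_x^\nu F(t,x)\|\le M_F$ for all $x\in\mathbb{R}^d$ and all multi-indices $\nu$ with $|\nu|=1,2$ ($F$ itself may be unbounded); and $m$ is continuous and bounded on $[0,T]\times\mathbb{R}^d$. For each $n\ge1$ let $0=t_0^n<t_1^n<\dots<t_n^n=T$ be a partition with steps $h_k^n=t_{k+1}^n-t_k^n$, $k=0,\dots,n-1$, such that there exists a constant $C>1$ with $C^{-1}\le h_k^n/h_l^n\le C$ for all $n\ge1$ and all $0\le k,l\le n-1$, and such that $\lim_{n\to\infty}h_1^n=0$. Let $x\in\mathbb{R}^d$ and let $X$ be the Markov chain $$X(t_{k+1}^n)=X(t_k^n)+h_k^n\{F(t_k^n,X(t_k^n))+m(t_k^n,X(t_k^n))\}+\sqrt{h_k^n}\,\sigma(t_k^n,X(t_k^n))\,\varepsilon(t_{k+1}^n),\qquad X(0)=x,$$ $k=0,\dots,n-1$, where the innovations $\varepsilon(t_1^n),\dots,\varepsilon(t_n^n)$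 are independent $\mathbb{R}^d$-valued random vectors. Then, for all sufficiently large $n$, each map $x\mapsto\widehat{\mathbf{g}}(t_k^n;0,x)$ defined in the context ($0\le k\le n$) is a $C^2$-diffeomorphism of $\mathbb{R}^d$, with inverse denoted $\widehat{\mathbf{g}}^{-1}(0;t_k^n,\cdot)$ and Jacobian matrix of the inverse denoted $\widehat{\mathbf{g}}_*^{-1}(0;t_k^n,y)$, and the process $$\widetilde X(t_k^n):=\widehat{\mathbf{g}}^{-1}(0;t_k^n,X(t_k^n)),\qquad k=0,\dots,n,$$ is a Markov chain satisfying, for $k=0,\dots,n-1$, $$\widetilde X(t_{k+1}^n)=\widetilde X(t_k^n)+h_k^n\,\widetilde m(t_k^n,\widetilde X(t_k^n),\varepsilon(t_{k+1}^n))+\sqrt{h_k^n}\,\widetilde\sigma(t_k^n,\widetilde X(t_k^n),\varepsilon(t_{k+1}^n))\,\varepsilon(t_{k+1}^n),$$ where, for $x,e\in\mathbb{R}^d$, $$\widetilde m(t_k^n,x,e)=\Big(\int_0^1\widehat{\mathbf{g}}_*^{-1}(0;t_{k+1}^n,\Psi_u(x,e))\,du\Big)\,m(t_k^n,\widehat{\mathbf{g}}(t_k^n;0,x)),$$ $$\widetilde\sigma(t_k^n,x,e)=\Big(\int_0^1\widehat{\mathbf{g}}_*^{-1}(0;t_{k+1}^n,\Psi_u(x,e))\,du\Big)\,\sigma(t_k^n,\widehat{\mathbf{g}}(t_k^n;0,x)),$$ $$\Psi_u(x,e)=\widehat{\mathbf{g}}(t_k^n;0,x)+h_k^nF(t_k^n,\widehat{\mathbf{g}}(t_k^n;0,x))+u\,h_k^n\,m(t_k^n,\widehat{\mathbf{g}}(t_k^n;0,x))+u\sqrt{h_k^n}\,\sigma(t_k^n,\widehat{\mathbf{g}}(t_k^n;0,x))\,e$$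 (the dependence of $\Psi_u$ on $k,n$ is suppressed), and the coefficients $\widetilde m$ and $\widetilde\sigma$ are bounded: there is a constant $C'<\infty$ with $\|\widetilde m(t_k^n,x,e)\|\le C'$ and $\|\widetilde\sigma(t_k^n,x,e)\|\le C'$ for all sufficiently large $n$, all $0\le k\le n-1$ and all $x,e\in\mathbb{R}^d$.
   Context: Assumptions. Uniform ellipticity: with $a:=\sigma\sigma^*$ ($\sigma^*$ the transpose of $\sigma$), there is $\Lambda\ge 1$ such that $\Lambda^{-1}|\xi|^2\le\langle a(t,x)\xi,\xi\rangle\le\Lambda|\xi|^2$ for all $(t,x,\xi)\in[0,T]\times(\mathbb{R}^d)^2$. Smoothness of the drift: $F$ is two times continuously differentiable in $[0,T]\times\mathbb{R}^d$, and there is a finite constant $M_F$ such that $\max_{t\in[0,T]}\|D_x^\nu F(t,x)\|\le M_F$ for all $x\in\mathbb{R}^d$ and all multi-indices $\nu$ with $|\nu|=1,2$. ($F$ itself may be unbounded.) Boundedness: $m$ is continuous and bounded on $[0,T]\times\mathbb{R}^d$. Partition steps: there exists a constant $C>1$ such that $C^{-1}\le h_k^n/h_l^n\le C$ for all $n\ge1$ and all $0\le k,l\le n-1$, and $\lim_{n\to\infty}h_1^n=0$. Notation. For $x\in\mathbb{R}^d$, $\widehat{\mathbf{g}}(t_k^n;0,x)$, $k=0,\dots,n$, denotes the Euler broken line for the ODE $\dot{\mathbf{x}}=F(t,\mathbf{x})$ started from $x$ at time $0$, i.e. the solution of the difference equation $$\widehat{\mathbf{g}}(t_{k+1}^n;0,x)=\widehat{\mathbf{g}}(t_k^n;0,x)+h_k^nF(t_k^n,\widehat{\mathbf{g}}(t_k^n;0,x)),\qquad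 \widehat{\mathbf{g}}(0;0,x)=x.$$ When $x\mapsto\widehat{\mathbf{g}}(t_k^n;0,x)$ is a diffeomorphism, $\widehat{\mathbf{g}}^{-1}(0;t_k^n,\cdot)$ denotes its inverse map and $\widehat{\mathbf{g}}_*^{-1}(0;t_k^n,y)=\big(\partial\widehat{\mathbf{g}}_i^{-1}(0;t_k^n,y)/\partial y_j\big)_{i,j=1}^d$ the Jacobian matrix of this inverse map at $y$.
   Formalization: It is assumed in addition that σ(t,·) is Borel measurable for each t in [0,T]; without this the recursion need not define random vectors, so X need not be a Markov chain. *)

theory Defs
  imports "HOL-Probability.Probability"
begin

text \<open>Twice continuous differentiability relative to a set \<open>S\<close>; on boundary points of
  \<open>S = {0..T} \<times> UNIV\<close> the derivatives are the one-sided ones. Continuity of \<open>f\<close> and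
  of its first derivative is implied by differentiability.\<close>

definition C2_on :: "'a::real_normed_vector set \<Rightarrow> ('a \<Rightarrow> 'b::real_normed_vector) \<Rightarrow> bool" where
  "C2_on S f \<longleftrightarrow>
    (\<exists>(f' :: 'a \<Rightarrow> 'a \<Rightarrow>\<^sub>L 'b) (f'' :: 'a \<Rightarrow> 'a \<Rightarrow>\<^sub>L ('a \<Rightarrow>\<^sub>L 'b)).
      (\<forall>z\<in>S. (f has_derivative blinfun_apply (f' z)) (at z within S)) \<and>
      (\<forall>z\<in>S. (f' has_derivative blinfun_apply (f'' z)) (at z within S)) \<and>
      continuous_on S f'')"

definition C2_diffeomorphism :: "('a::real_normed_vector \<Rightarrow> 'a) \<Rightarrow> bool" where
  "C2_diffeomorphism f \<longleftrightarrow> bij f \<and> C2_on UNIV f \<and> C2_on UNIV (inv f)"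

definition partial_diff :: "'d \<Rightarrow> (real ^ 'd \<Rightarrow> 'b::real_normed_vector) \<Rightarrow> real ^ 'd \<Rightarrow> 'b" where
  "partial_diff i f x = vector_derivative (\<lambda>s. f (x + s *\<^sub>R axis i 1)) (at 0)"

text \<open>A multi-index is represented by a list of coordinates, so that its order is the length of
  the list. For twice continuously differentiable functions the ordering of the list is
  immaterial up to order two.\<close>

fun multi_diff :: "'d list \<Rightarrow> (real ^ 'd \<Rightarrow> 'b::real_normed_vector) \<Rightarrow> real ^ 'd \<Rightarrow> 'b" where
  "multi_diff [] f = f"
| "multi_diff (i # \<nu>) f = partial_diff i (multi_diff \<nu> f)"

text \<open>Markov property of \<open>X 0, \<dots>, X n\<close> with respect to the natural filtration, where
  conditioning on random variables is conditioning on the sigma-algebra they generate.\<close>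

definition markov_chain ::
    "'w measure \<Rightarrow> nat \<Rightarrow> (nat \<Rightarrow> 'w \<Rightarrow> 'a::topological_space) \<Rightarrow> bool" where
  "markov_chain M n X \<longleftrightarrow>
    prob_space M \<and>
    (\<forall>k\<le>n. X k \<in> borel_measurable M) \<and>
    (\<forall>k<n. \<forall>A\<in>sets borel. AE \<omega> in M.
      real_cond_exp M
        (vimage_algebra (space M) (\<lambda>\<omega>. \<lambda>i\<in>{..k}. X i \<omega>) (\<Pi>\<^sub>M i\<in>{..k}. borel))
        (\<lambda>\<omega>. indicator A (X (Suc k) \<omega>)) \<omega> =
      real_cond_exp M
        (vimage_algebra (space M) (X k) borel)
        (\<lambda>\<omega>. indicator A (X (Suc k) \<omega>)) \<omega>)"

text \<open>From here on \<open>\<tau>\<close> is a single partition, \<open>\<tau> k\<close> being its \<open>k\<close>-th point.\<close>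

definition step :: "(nat \<Rightarrow> real) \<Rightarrow> nat \<Rightarrow> real" where
  "step \<tau> k = \<tau> (Suc k) - \<tau> k"

fun ghat :: "(real \<Rightarrow> real ^ 'd \<Rightarrow> real ^ 'd) \<Rightarrow> (nat \<Rightarrow> real) \<Rightarrow> nat \<Rightarrow> real ^ 'd \<Rightarrow> real ^ 'd" where
  "ghat F \<tau> 0 x = x"
| "ghat F \<tau> (Suc k) x = ghat F \<tau> k x + step \<tau> k *\<^sub>R F (\<tau> k) (ghat F \<tau> k x)"

abbreviation ghat_inv ::
    "(real \<Rightarrow> real ^ 'd \<Rightarrow> real ^ 'd) \<Rightarrow> (nat \<Rightarrow> real) \<Rightarrow> nat \<Rightarrow> real ^ 'd \<Rightarrow> real ^ 'd" where
  "ghat_inv F \<tau> k \<equiv> inv (ghat F \<tau> k)"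

definition ghat_inv_jac ::
    "(real \<Rightarrow> real ^ 'd \<Rightarrow> real ^ 'd) \<Rightarrow> (nat \<Rightarrow> real) \<Rightarrow> nat \<Rightarrow> real ^ 'd \<Rightarrow> real ^ 'd ^ 'd" where
  "ghat_inv_jac F \<tau> k y = jacobian (ghat_inv F \<tau> k) (at y)"

definition Psi ::
    "(real \<Rightarrow> real ^ 'd \<Rightarrow> real ^ 'd) \<Rightarrow> (real \<Rightarrow> real ^ 'd \<Rightarrow> real ^ 'd) \<Rightarrow>
     (real \<Rightarrow> real ^ 'd \<Rightarrow> real ^ 'd ^ 'd) \<Rightarrow> (nat \<Rightarrow> real) \<Rightarrow> nat \<Rightarrow>
     real \<Rightarrow> real ^ 'd \<Rightarrow> real ^ 'd \<Rightarrow> real ^ 'd" where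
  "Psi F m \<sigma> \<tau> k u x e =
     ghat F \<tau> k x + step \<tau> k *\<^sub>R F (\<tau> k) (ghat F \<tau> k x)
     + (u * step \<tau> k) *\<^sub>R m (\<tau> k) (ghat F \<tau> k x)
     + (u * sqrt (step \<tau> k)) *\<^sub>R (\<sigma> (\<tau> k) (ghat F \<tau> k x) *v e)"

definition m_tilde ::
    "(real \<Rightarrow> real ^ 'd \<Rightarrow> real ^ 'd) \<Rightarrow> (real \<Rightarrow> real ^ 'd \<Rightarrow> real ^ 'd) \<Rightarrow>
     (real \<Rightarrow> real ^ 'd \<Rightarrow> real ^ 'd ^ 'd) \<Rightarrow> (nat \<Rightarrow> real) \<Rightarrow> nat \<Rightarrow>
     real ^ 'd \<Rightarrow> real ^ 'd \<Rightarrow> real ^ 'd" where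
  "m_tilde F m \<sigma> \<tau> k x e =
     integral {0..1} (\<lambda>u. ghat_inv_jac F \<tau> (Suc k) (Psi F m \<sigma> \<tau> k u x e))
     *v m (\<tau> k) (ghat F \<tau> k x)"

definition sigma_tilde ::
    "(real \<Rightarrow> real ^ 'd \<Rightarrow> real ^ 'd) \<Rightarrow> (real \<Rightarrow> real ^ 'd \<Rightarrow> real ^ 'd) \<Rightarrow>
     (real \<Rightarrow> real ^ 'd \<Rightarrow> real ^ 'd ^ 'd) \<Rightarrow> (nat \<Rightarrow> real) \<Rightarrow> nat \<Rightarrow>
     real ^ 'd \<Rightarrow> real ^ 'd \<Rightarrow> real ^ 'd ^ 'd" where
  "sigma_tilde F m \<sigma> \<tau> k x e =
     integral {0..1} (\<lambda>u. ghat_inv_jac F \<tau> (Suc k) (Psi F m \<sigma> \<tau> k u x e))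
     ** \<sigma> (\<tau> k) (ghat F \<tau> k x)"

end

theory Submission
  imports Defs
begin

text \<open>
  Each Euler step \<open>y \<mapsto> y + h F(t, y)\<close> is a Lipschitz perturbation of the identity; once
  \<open>h L \<le> 1/2\<close> it is a \<open>C\<^sup>2\<close> diffeomorphism that contracts distances by a factor at most
  \<open>exp (2 L h)\<close>. The factors multiply up to \<open>exp (2 L T)\<close>, so the inverse flows are
  Lipschitz, and their Jacobians bounded, uniformly in \<open>k\<close> and \<open>n\<close>. The formula for the
  transformed chain is the fundamental theorem of calculus along the segment \<open>\<Psi>\<^sub>u\<close>, which runs
  from the deterministic Euler step to the next state. The transformed chain has the form
  \<open>Y\<^sub>k\<^sub>+\<^sub>1 = G\<^sub>k(Y\<^sub>k, \<epsilon>\<^sub>k\<^sub>+\<^sub>1)\<close> with \<open>\<epsilon>\<^sub>k\<^sub>+\<^sub>1\<close> independent of the past, so by Fubini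
  both conditional expectations in the Markov property are the same function of \<open>Y\<^sub>k\<close>.
\<close>

section \<open>Twice continuously differentiable maps\<close>

text \<open>\<open>C2_on\<close> requires the second derivative to be a bounded linear operator into
  a space of bounded linear operators. Left and right composition are therefore packaged as
  operators themselves, so that product rule terms can be written as elements of the right
  type.\<close>

abbreviation compose_left :: "('b::real_normed_vector \<Rightarrow>\<^sub>L 'c::real_normed_vector)
    \<Rightarrow> ('a::real_normed_vector \<Rightarrow>\<^sub>L 'b) \<Rightarrow>\<^sub>L ('a \<Rightarrow>\<^sub>L 'c)"
  where "compose_left \<equiv> bounded_bilinear.prod_right (o\<^sub>L)"

abbreviation compose_right :: "('a::real_normed_vector \<Rightarrow>\<^sub>L 'b::real_normed_vector)
    \<Rightarrow> ('b \<Rightarrow>\<^sub>L 'c::real_normed_vector) \<Rightarrow>\<^sub>L ('a \<Rightarrow>\<^sub>L 'c)"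
  where "compose_right \<equiv> bounded_bilinear.prod_left (o\<^sub>L)"

lemmas compose_left_apply [simp] =
  bounded_bilinear.prod_right.rep_eq[OF bounded_bilinear_blinfun_compose]

lemmas compose_right_apply [simp] =
  bounded_bilinear.prod_left.rep_eq[OF bounded_bilinear_blinfun_compose]

lemmas continuous_on_compose_left [continuous_intros] = bounded_linear.continuous_on
  [OF bounded_bilinear.bounded_linear_prod_right[OF bounded_bilinear_blinfun_compose]]

lemmas continuous_on_compose_right [continuous_intros] = bounded_linear.continuous_on
  [OF bounded_bilinear.bounded_linear_prod_left[OF bounded_bilinear_blinfun_compose]]

lemma C2_onE:
  assumes "C2_on UNIV f"
  obtains f' f'' where "\<And>x. (f has_derivative blinfun_apply (f' x)) (at x)"
    and "\<And>x. (f' has_derivative blinfun_apply (f'' x)) (at x)"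
    and "continuous_on UNIV f''" "continuous_on UNIV f'" "continuous_on UNIV f"
proof -
  from assms obtain f' f''
    where f': "\<And>x. (f has_derivative blinfun_apply (f' x)) (at x)"
      and f'': "\<And>x. (f' has_derivative blinfun_apply (f'' x)) (at x)"
      and "continuous_on UNIV f''"
    unfolding C2_on_def by auto
  moreover have "continuous_on UNIV f'" "continuous_on UNIV f"
    unfolding continuous_on_eq_continuous_at[OF open_UNIV]
    using has_derivative_continuous[OF f'] has_derivative_continuous[OF f''] by auto
  ultimately show ?thesis using that by blast
qed

lemma C2_on_UNIV_I:
  assumes "\<And>x. (f has_derivative blinfun_apply (f' x)) (at x)"
    and "\<And>x. (f' has_derivative blinfun_apply (f'' x)) (at x)"
    and "continuous_on UNIV f''"
  shows "C2_on UNIV f"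
  using assms unfolding C2_on_def by auto

lemma C2_on_ident: "C2_on UNIV (\<lambda>x. x)"
  by (rule C2_on_UNIV_I[where f' = "\<lambda>_. id_blinfun" and f'' = "\<lambda>_. 0"])
    (auto simp: id_blinfun.rep_eq intro!: derivative_eq_intros)

lemma C2_on_add:
  assumes "C2_on UNIV f" "C2_on UNIV g"
  shows "C2_on UNIV (\<lambda>x. f x + g x)"
proof -
  obtain f' f'' where f: "\<And>x. (f has_derivative blinfun_apply (f' x)) (at x)"
      "\<And>x. (f' has_derivative blinfun_apply (f'' x)) (at x)" "continuous_on UNIV f''"
    using C2_onE[OF assms(1)] by metis
  obtain g' g'' where g: "\<And>x. (g has_derivative blinfun_apply (g' x)) (at x)"
      "\<And>x. (g' has_derivative blinfun_apply (g'' x)) (at x)" "continuous_on UNIV g''"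
    using C2_onE[OF assms(2)] by metis
  show ?thesis
    by (rule C2_on_UNIV_I[where f' = "\<lambda>x. f' x + g' x" and f'' = "\<lambda>x. f'' x + g'' x"])
      (auto simp: plus_blinfun.rep_eq intro!: has_derivative_add f g continuous_intros)
qed

lemma C2_on_scaleR:
  assumes "C2_on UNIV f"
  shows "C2_on UNIV (\<lambda>x. c *\<^sub>R f x)"
proof -
  obtain f' f'' where f: "\<And>x. (f has_derivative blinfun_apply (f' x)) (at x)"
      "\<And>x. (f' has_derivative blinfun_apply (f'' x)) (at x)" "continuous_on UNIV f''"
    using C2_onE[OF assms(1)] by metis
  show ?thesis
    by (rule C2_on_UNIV_I[where f' = "\<lambda>x. c *\<^sub>R f' x" and f'' = "\<lambda>x. c *\<^sub>R f'' x"])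
      (auto simp: scaleR_blinfun.rep_eq intro!: has_derivative_scaleR_right f continuous_intros)
qed

lemma C2_on_compose:
  assumes "C2_on UNIV f" "C2_on UNIV g"
  shows "C2_on UNIV (\<lambda>x. g (f x))"
proof -
  obtain f' f'' where f: "\<And>x. (f has_derivative blinfun_apply (f' x)) (at x)"
      "\<And>x. (f' has_derivative blinfun_apply (f'' x)) (at x)"
      "continuous_on UNIV f''" "continuous_on UNIV f'" "continuous_on UNIV f"
    using C2_onE[OF assms(1)] by metis
  obtain g' g'' where g: "\<And>x. (g has_derivative blinfun_apply (g' x)) (at x)"
      "\<And>x. (g' has_derivative blinfun_apply (g'' x)) (at x)"
      "continuous_on UNIV g''" "continuous_on UNIV g'"
    using C2_onE[OF assms(2)] by metis
  \<comment> \<open>Product rule for the bilinear composition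
    \<open>g' (f x) o\<^sub>L f' x\<close>: the first summand differentiates \<open>f'\<close>, the
    second differentiates \<open>g'\<close> along \<open>f\<close>.\<close>
  let ?h'' = "\<lambda>x. (compose_left (g' (f x)) o\<^sub>L f'' x)
    + (compose_right (f' x) o\<^sub>L (g'' (f x) o\<^sub>L f' x))"
  show ?thesis
  proof (rule C2_on_UNIV_I[where f' = "\<lambda>x. g' (f x) o\<^sub>L f' x" and f'' = ?h''])
    show "((\<lambda>x. g (f x)) has_derivative (g' (f x) o\<^sub>L f' x)) (at x)" for x
      using has_derivative_compose[OF f(1) g(1), of x] by (simp add: blinfun_compose.rep_eq o_def)
    have "((\<lambda>x. g' (f x)) has_derivative (\<lambda>h. g'' (f x) (f' x h))) (at x)" for x
      using has_derivative_compose[OF f(1) g(2)] .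
    from bounded_bilinear.FDERIV[OF bounded_bilinear_blinfun_compose this f(2)]
    show "((\<lambda>x. g' (f x) o\<^sub>L f' x) has_derivative ?h'' x) (at x)" for x
      by (simp add: plus_blinfun.rep_eq blinfun_compose.rep_eq o_def)
    show "continuous_on UNIV ?h''"
      using f g continuous_on_compose2[OF g(3) f(5)] continuous_on_compose2[OF g(4) f(5)]
      by (intro continuous_intros bounded_bilinear.continuous_on[OF bounded_bilinear_blinfun_compose])
        auto
  qed
qed

text \<open>Freezing the time is composition with the affine map sending y to (s, y), whose
  derivative is the constant operator \<open>\<iota>\<close>. The whole line {s} x UNIV lies in the
  domain, so derivatives that are one-sided in time at the end points still give full derivatives in
  y.\<close>

lemma C2_on_slice:
  assumes F: "C2_on (S \<times> UNIV) (\<lambda>(s, y). F s y)" and s: "s \<in> S"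
  shows "C2_on UNIV (F s)"
proof -
  from F obtain f' f''
    where f': "\<And>z. z \<in> S \<times> UNIV \<Longrightarrow>
        ((\<lambda>(s, y). F s y) has_derivative blinfun_apply (f' z)) (at z within S \<times> UNIV)"
      and f'': "\<And>z. z \<in> S \<times> UNIV \<Longrightarrow>
        (f' has_derivative blinfun_apply (f'' z)) (at z within S \<times> UNIV)"
      and cont: "continuous_on (S \<times> UNIV) f''"
    unfolding C2_on_def by blast
  define \<iota> where "\<iota> = Blinfun (\<lambda>y::'b. (0::'a, y))"
  have \<iota>: "blinfun_apply \<iota> = (\<lambda>y. (0, y))"
    unfolding \<iota>_def by (intro bounded_linear_Blinfun_apply bounded_linear_Pair
        bounded_linear_zero bounded_linear_ident)
  have d: "(Pair s has_derivative (\<lambda>h. (0, h))) (at y)" for y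
    by (auto intro!: derivative_eq_intros)
  have sub: "Pair s ` UNIV \<subseteq> S \<times> UNIV"
    using s by auto
  have sl: "((\<lambda>y. g (s, y)) has_derivative (\<lambda>h. g' (0, h))) (at y)"
    if "(g has_derivative g') (at (s, y) within S \<times> UNIV)" for g :: "'a \<times> 'b \<Rightarrow> 'z::real_normed_vector" and g' y
    using has_derivative_in_compose[OF d has_derivative_subset[OF that sub]] by simp
  show ?thesis
  proof (rule C2_on_UNIV_I[where f' = "\<lambda>y. f' (s, y) o\<^sub>L \<iota>"
        and f'' = "\<lambda>y. compose_right \<iota> o\<^sub>L (f'' (s, y) o\<^sub>L \<iota>)"])
    show "(F s has_derivative (f' (s, y) o\<^sub>L \<iota>)) (at y)" for y
      using sl[OF f'] s by (simp add: blinfun_compose.rep_eq o_def \<iota>)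
    have "((\<lambda>y. f' (s, y) o\<^sub>L \<iota>) has_derivative (\<lambda>h. f'' (s, y) (0, h) o\<^sub>L \<iota>)) (at y)" for y
      using sl[OF f''] s
      by (intro bounded_linear.has_derivative
          [OF bounded_bilinear.bounded_linear_left[OF bounded_bilinear_blinfun_compose]]) auto
    then show "((\<lambda>y. f' (s, y) o\<^sub>L \<iota>) has_derivative
        (compose_right \<iota> o\<^sub>L (f'' (s, y) o\<^sub>L \<iota>))) (at y)" for y
      by (simp add: blinfun_compose.rep_eq o_def \<iota>)
    have "continuous_on UNIV (\<lambda>y. f'' (s, y))"
      using s by (intro continuous_on_compose2[OF cont]) (auto intro!: continuous_intros)
    then show "continuous_on UNIV (\<lambda>y. compose_right \<iota> o\<^sub>L (f'' (s, y) o\<^sub>L \<iota>))"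
      by (intro continuous_intros bounded_bilinear.continuous_on[OF bounded_bilinear_blinfun_compose])
  qed
qed

section \<open>Global inversion of expanding maps of class C^2\<close>

text \<open>A product rule in which one factor is merely continuous. Since \<open>g\<close> vanishes
  at \<open>x\<close>, \<open>g z\<close> is of order |z - x|; multiplied by
  \<open>a z - a x\<close>, which tends to 0, it becomes negligible, so \<open>a\<close> may be
  frozen at \<open>x\<close>. It serves to differentiate a field of inverse operators that is so far
  known only to be continuous.\<close>

lemma has_derivative_continuous_mult_vanishing:
  assumes bil: "bounded_bilinear pr"
    and g: "(g has_derivative g') (at x)" and g0: "g x = 0" and a: "isCont a x"
  shows "((\<lambda>z. pr (a z) (g z)) has_derivative (\<lambda>h. pr (a x) (g' h))) (at x)"
proof -
  interpret bounded_bilinear pr by (rule bil)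
  interpret g': bounded_linear g' using has_derivative_bounded_linear[OF g] .
  have "((\<lambda>z. pr (a z - a x) (g z)) has_derivative (\<lambda>h. 0)) (at x)"
    unfolding has_derivative_iff_norm
  proof safe
    obtain K where K: "\<And>a b. norm (pr a b) \<le> norm a * norm b * K"
      using bounded by blast
    obtain B where B: "\<And>h. norm (g' h) \<le> norm h * B"
      using g'.bounded by blast
    have q: "((\<lambda>z. norm (g z - g x - g' (z - x)) / norm (z - x)) \<longlongrightarrow> 0) (at x)"
      using g by (simp add: has_derivative_iff_norm)
    have "((\<lambda>z. \<bar>K\<bar> * (norm (a z - a x) * (norm (g z - g x - g' (z - x)) / norm (z - x) + B)))
        \<longlongrightarrow> \<bar>K\<bar> * (norm (a x - a x) * (0 + B))) (at x)"
      by (intro tendsto_intros q a[unfolded isCont_def])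
    then have lim: "((\<lambda>z. \<bar>K\<bar> * (norm (a z - a x) * (norm (g z - g x - g' (z - x)) / norm (z - x) + B)))
        \<longlongrightarrow> 0) (at x)"
      by simp
    have le: "norm (pr (a z - a x) (g z)) / norm (z - x)
        \<le> \<bar>K\<bar> * (norm (a z - a x) * (norm (g z - g x - g' (z - x)) / norm (z - x) + B))"
      if "z \<noteq> x" for z
    proof -
      have "norm (g z) \<le> norm (g z - g x - g' (z - x)) + norm (g' (z - x))"
        by (metis diff_add_cancel diff_zero g0 norm_triangle_ineq)
      also have "\<dots> \<le> norm (g z - g x - g' (z - x)) + norm (z - x) * B"
        using B by simp
      finally have 1: "norm (g z) / norm (z - x) \<le> norm (g z - g x - g' (z - x)) / norm (z - x) + B"
        using that by (simp add: field_simps)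
      have "norm (pr (a z - a x) (g z)) \<le> norm (a z - a x) * norm (g z) * \<bar>K\<bar>"
        using K[of "a z - a x" "g z"] abs_ge_self[of K]
        by (meson mult_left_mono mult_nonneg_nonneg norm_ge_zero order_trans)
      then have "norm (pr (a z - a x) (g z)) / norm (z - x)
          \<le> \<bar>K\<bar> * (norm (a z - a x) * (norm (g z) / norm (z - x)))"
        by (simp add: divide_right_mono mult.commute mult.left_commute)
      also have "\<dots> \<le> \<bar>K\<bar> * (norm (a z - a x) * (norm (g z - g x - g' (z - x)) / norm (z - x) + B))"
        using 1 by (intro mult_left_mono) auto
      finally show ?thesis .
    qed
    show "((\<lambda>y. norm (pr (a y - a x) (g y) - pr (a x - a x) (g x) - 0) / norm (y - x)) \<longlongrightarrow> 0) (at x)"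
      by (rule tendsto_sandwich[OF _ _ tendsto_const lim])
        (auto simp: eventually_at_filter zero_left le intro!: always_eventually)
  qed simp
  moreover have "((\<lambda>z. pr (a x) (g z)) has_derivative (\<lambda>h. pr (a x) (g' h))) (at x)"
    by (rule bounded_linear.has_derivative[OF bounded_linear_right g])
  ultimately have "((\<lambda>z. pr (a x) (g z) + pr (a z - a x) (g z))
      has_derivative (\<lambda>h. pr (a x) (g' h) + 0)) (at x)"
    by (rule has_derivative_add[rotated])
  then show ?thesis
    by (simp add: diff_left)
qed

lemma has_derivative_difference_quotient:
  assumes "(f has_derivative f') (at x)"
  shows "((\<lambda>r. (f (x + r *\<^sub>R v) - f x) /\<^sub>R r) \<longlongrightarrow> f' v) (at 0)"
proof -
  have 1: "((\<lambda>r. x + r *\<^sub>R v) has_derivative (\<lambda>r. r *\<^sub>R v)) (at 0)"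
    by (auto intro!: derivative_eq_intros)
  have 2: "(f has_derivative f') (at (x + 0 *\<^sub>R v))"
    using assms by simp
  have "((\<lambda>r. f (x + r *\<^sub>R v)) has_vector_derivative f' v) (at 0)"
    using has_derivative_compose[OF 1 2]
    by (simp add: has_vector_derivative_def linear_cmul[OF has_derivative_linear[OF assms]])
  then have lim: "((\<lambda>r. norm (f (x + r *\<^sub>R v) - f x - r *\<^sub>R f' v) / \<bar>r\<bar>) \<longlongrightarrow> 0) (at 0)"
    by (simp add: has_vector_derivative_def has_derivative_iff_norm)
  have "norm (f (x + r *\<^sub>R v) - f x - r *\<^sub>R f' v) / \<bar>r\<bar>
      = norm ((f (x + r *\<^sub>R v) - f x) /\<^sub>R r - f' v)" if "r \<noteq> 0" for r
  proof -
    have "(f (x + r *\<^sub>R v) - f x) /\<^sub>R r - f' v = (f (x + r *\<^sub>R v) - f x - r *\<^sub>R f' v) /\<^sub>R r"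
      using that by (simp add: scaleR_diff_right)
    then show ?thesis by (simp add: divide_inverse mult.commute)
  qed
  then have "((\<lambda>r. norm ((f (x + r *\<^sub>R v) - f x) /\<^sub>R r - f' v)) \<longlongrightarrow> 0) (at 0)"
    by (intro Lim_transform_eventually[OF lim]) (auto simp: eventually_at_filter)
  then show ?thesis
    by (rule LIM_zero_cancel[OF tendsto_norm_zero_cancel])
qed

text \<open>The expansion bound passes to the limit in the difference quotients along
  \<open>v\<close>. This makes the derivative injective and controls its inverse.\<close>

lemma norm_derivative_ge:
  assumes f: "(f has_derivative f') (at x)" and c: "0 \<le> c"
    and exp: "\<And>x y. norm (x - y) \<le> c * norm (f x - f y)"
  shows "norm v \<le> c * norm (f' v)"
proof (rule tendsto_lowerbound)
  show "((\<lambda>r. c * norm ((f (x + r *\<^sub>R v) - f x) /\<^sub>R r)) \<longlongrightarrow> c * norm (f' v)) (at 0)"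
    by (intro tendsto_intros has_derivative_difference_quotient f)
  have "norm v \<le> c * norm ((f (x + r *\<^sub>R v) - f x) /\<^sub>R r)" if "r \<noteq> 0" for r
  proof -
    have "norm v * \<bar>r\<bar> \<le> c * norm (f (x + r *\<^sub>R v) - f x)"
      using exp[of "x + r *\<^sub>R v" x] by (simp add: mult.commute)
    then have "norm v \<le> c * norm (f (x + r *\<^sub>R v) - f x) / \<bar>r\<bar>"
      using that by (subst pos_le_divide_eq) simp_all
    then show ?thesis by (simp add: divide_inverse mult_ac)
  qed
  then show "\<forall>\<^sub>F r in at 0. norm v \<le> c * norm ((f (x + r *\<^sub>R v) - f x) /\<^sub>R r)"
    by (auto simp: eventually_at_filter intro!: always_eventually)
qed simp

lemma norm_derivative_le:
  assumes f: "(f has_derivative f') (at x)"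
    and lip: "\<And>x y. norm (f x - f y) \<le> c * norm (x - y)"
  shows "norm (f' v) \<le> c * norm v"
proof (rule tendsto_upperbound)
  show "((\<lambda>r. norm ((f (x + r *\<^sub>R v) - f x) /\<^sub>R r)) \<longlongrightarrow> norm (f' v)) (at 0)"
    by (intro tendsto_intros has_derivative_difference_quotient f)
  have "norm ((f (x + r *\<^sub>R v) - f x) /\<^sub>R r) \<le> c * norm v" if "r \<noteq> 0" for r
  proof -
    have "norm (f (x + r *\<^sub>R v) - f x) \<le> (c * norm v) * \<bar>r\<bar>"
      using lip[of "x + r *\<^sub>R v" x] by (simp add: mult_ac)
    then have "norm (f (x + r *\<^sub>R v) - f x) / \<bar>r\<bar> \<le> c * norm v"
      using that by (subst pos_divide_le_eq) simp_all
    then show ?thesis by (simp add: divide_inverse mult_ac)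
  qed
  then show "\<forall>\<^sub>F r in at 0. norm ((f (x + r *\<^sub>R v) - f x) /\<^sub>R r) \<le> c * norm v"
    by (auto simp: eventually_at_filter intro!: always_eventually)
qed simp

text \<open>The expansion bound yields injectivity and a \<open>c\<close>-Lipschitz inverse map at
  once. It also makes every \<open>f' x\<close> injective, hence invertible in finite dimension,
  with an inverse \<open>J x\<close> of norm at most \<open>c\<close>. The derivative of
  \<open>inv f\<close> is then \<open>J\<close> along \<open>inv f\<close>, so it remains to show
  that \<open>J\<close> is continuously differentiable.\<close>

lemma C2_diffeomorphismI:
  fixes f :: "'a::euclidean_space \<Rightarrow> 'a"
  assumes C2: "C2_on UNIV f" and surj: "surj f" and c: "0 \<le> c"
    and exp: "\<And>x y. norm (x - y) \<le> c * norm (f x - f y)"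
  shows "C2_diffeomorphism f"
proof -
  obtain f' f'' where f: "\<And>x. (f has_derivative blinfun_apply (f' x)) (at x)"
      "\<And>x. (f' has_derivative blinfun_apply (f'' x)) (at x)"
      "continuous_on UNIV f''" "continuous_on UNIV f'"
    using C2_onE[OF C2] by metis
  have inj: "inj f"
    using exp by (intro injI) (metis cancel_comm_monoid_add_class.diff_cancel eq_iff_diff_eq_0 mult_zero_right norm_le_zero_iff norm_zero)
  have f_inv: "f (inv f y) = y" for y
    by (simp add: surj surj_f_inv_f)
  have lip: "norm (inv f y - inv f z) \<le> c * norm (y - z)" for y z
    using exp[of "inv f y" "inv f z"] by (simp add: f_inv)
  have lb: "norm v \<le> c * norm (f' x v)" for x v
    by (rule norm_derivative_ge[OF f(1) c exp])
  have "\<exists>A. f' x o\<^sub>L A = id_blinfun \<and> A o\<^sub>L f' x = id_blinfun" for x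
  proof -
    have lin: "linear (f' x)"
      by (simp add: blinfun.bounded_linear_right bounded_linear.linear)
    have "inj (f' x)"
      unfolding linear_injective_0[OF lin]
    proof safe
      fix v assume "f' x v = 0"
      then show "v = 0" using lb[of v x] by simp
    qed
    then obtain A where A: "linear A" "\<And>v. A (f' x v) = v" "\<And>v. f' x (A v) = v"
      using linear_injective_isomorphism[OF lin] by blast
    then have "blinfun_apply (Blinfun A) = A"
      by (simp add: bounded_linear_Blinfun_apply linear_conv_bounded_linear)
    with A have "f' x o\<^sub>L Blinfun A = id_blinfun \<and> Blinfun A o\<^sub>L f' x = id_blinfun"
      by (auto intro!: blinfun_eqI)
    then show ?thesis by blast
  qed
  then obtain J where J: "\<And>x. f' x o\<^sub>L J x = id_blinfun" "\<And>x. J x o\<^sub>L f' x = id_blinfun"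
    by metis
  have J1: "f' x (J x v) = v" and J2: "J x (f' x v) = v" for x v
    using J(1)[of x] J(2)[of x] by (metis blinfun_apply_blinfun_compose blinfun_apply_id_blinfun)+
  \<comment> \<open>The resolvent identity J z - J x = J z (f' x - f' z) J x. With the uniform bound
    on \<open>J z\<close> it gives continuity of \<open>J\<close>, and afterwards its
    differentiability.\<close>
  have J_diff: "J x + (J z o\<^sub>L ((f' x - f' z) o\<^sub>L J x)) = J z" for x z
    by (rule blinfun_eqI) (simp add: blinfun.bilinear_simps J1 J2)
  have J_norm: "norm (J x) \<le> c" for x
    by (rule norm_blinfun_bound[OF c]) (use lb[of "J x _" x] in \<open>simp add: J1\<close>)
  have J_cont: "isCont J x" for x
  proof -
    have "isCont f' x" using f(4) by (simp add: continuous_on_eq_continuous_at)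
    then have "((\<lambda>z. c * (norm (f' x - f' z) * norm (J x))) \<longlongrightarrow> c * (norm (f' x - f' x) * norm (J x))) (at x)"
      unfolding isCont_def by (intro tendsto_intros)
    then have lim: "((\<lambda>z. c * (norm (f' x - f' z) * norm (J x))) \<longlongrightarrow> 0) (at x)"
      by simp
    have le: "norm (J z - J x) \<le> c * (norm (f' x - f' z) * norm (J x))" for z
    proof -
      have "norm (J z - J x) = norm (J z o\<^sub>L ((f' x - f' z) o\<^sub>L J x))"
        using J_diff[of x z] by (metis add_diff_cancel_left')
      also have "\<dots> \<le> norm (J z) * norm ((f' x - f' z) o\<^sub>L J x)"
        by (rule norm_blinfun_compose)
      also have "\<dots> \<le> c * (norm (f' x - f' z) * norm (J x))"
        by (intro mult_mono J_norm norm_blinfun_compose) (auto simp: c)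
      finally show ?thesis .
    qed
    then show ?thesis
      unfolding isCont_def LIM_zero_iff[symmetric, of J]
      by (intro Lim_null_comparison[OF _ lim] always_eventually) auto
  qed
  \<comment> \<open>The derivative of operator inversion: \<open>J' x\<close> maps h to minus
    \<open>J x o\<^sub>L (f'' x h o\<^sub>L J x)\<close>.\<close>
  define J' where "J' x = - (compose_left (J x) o\<^sub>L (compose_right (J x) o\<^sub>L f'' x))" for x
  have J': "(J has_derivative J' x) (at x)" for x
  proof -
    have "((\<lambda>z. (f' x - f' z) o\<^sub>L J x) has_derivative (\<lambda>h. (0 - f'' x h) o\<^sub>L J x)) (at x)"
      by (intro bounded_linear.has_derivative
          [OF bounded_bilinear.bounded_linear_left[OF bounded_bilinear_blinfun_compose]]
          has_derivative_diff has_derivative_const f)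
    \<comment> \<open>In the resolvent identity the right factor vanishes at z = x, so continuity of
      the left factor \<open>J z\<close> suffices.\<close>
    from has_derivative_continuous_mult_vanishing[OF bounded_bilinear_blinfun_compose this _ J_cont]
    have "((\<lambda>z. J z o\<^sub>L ((f' x - f' z) o\<^sub>L J x)) has_derivative
        (\<lambda>h. J x o\<^sub>L ((0 - f'' x h) o\<^sub>L J x))) (at x)"
      by (simp add: bounded_bilinear.zero_left[OF bounded_bilinear_blinfun_compose])
    from has_derivative_add[OF has_derivative_const[of "J x"] this]
    have "(J has_derivative (\<lambda>h. 0 + (J x o\<^sub>L ((0 - f'' x h) o\<^sub>L J x)))) (at x)"
      by (simp only: J_diff)
    moreover have "blinfun_apply (J' x) = (\<lambda>h. 0 + (J x o\<^sub>L ((0 - f'' x h) o\<^sub>L J x)))"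
      by (auto simp: J'_def fun_eq_iff blinfun.bilinear_simps
         bounded_bilinear.minus_left[OF bounded_bilinear_blinfun_compose]
         bounded_bilinear.minus_right[OF bounded_bilinear_blinfun_compose])
    ultimately show ?thesis by simp
  qed
  have inv_cont: "isCont (inv f) y" for y
  proof -
    have "((\<lambda>z. c * norm (z - y)) \<longlongrightarrow> c * norm (y - y)) (at y)"
      by (intro tendsto_intros)
    then have lim: "((\<lambda>z. c * norm (z - y)) \<longlongrightarrow> 0) (at y)"
      by simp
    show ?thesis
      unfolding isCont_def LIM_zero_iff[symmetric, of "inv f"]
      by (intro Lim_null_comparison[OF _ lim] always_eventually) (auto simp: lip)
  qed
  have inv': "(inv f has_derivative J (inv f y)) (at y)" for y
    by (rule has_derivative_inverse_basic[OF f(1) _ _ inv_cont open_UNIV])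
      (auto simp: f_inv J2 fun_eq_iff blinfun.bounded_linear_right)
  have "C2_on UNIV (inv f)"
  proof (rule C2_on_UNIV_I[OF inv', where f'' = "\<lambda>y. J' (inv f y) o\<^sub>L J (inv f y)"])
    show "((\<lambda>y. J (inv f y)) has_derivative (J' (inv f y) o\<^sub>L J (inv f y))) (at y)" for y
      using has_derivative_compose[OF inv' J', of y] by (simp add: blinfun_compose.rep_eq o_def)
    have cJ: "continuous_on UNIV J" and ci: "continuous_on UNIV (inv f)"
      using J_cont inv_cont by (auto simp: continuous_on_eq_continuous_at)
    have cJ': "continuous_on UNIV J'"
      unfolding J'_def using f(3) cJ
      by (intro continuous_intros bounded_bilinear.continuous_on[OF bounded_bilinear_blinfun_compose])
    show "continuous_on UNIV (\<lambda>y. J' (inv f y) o\<^sub>L J (inv f y))"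
      by (intro bounded_bilinear.continuous_on[OF bounded_bilinear_blinfun_compose]
          continuous_on_compose2[OF cJ ci] continuous_on_compose2[OF cJ' ci]) auto
  qed
  then show ?thesis
    unfolding C2_diffeomorphism_def using C2 inj surj by (simp add: bij_def)
qed

section \<open>Markov chains generated by recursions\<close>

text \<open>Freezing lemma: conditionally on \<open>W\<close>, the independent variable
  \<open>Z\<close> is integrated out with \<open>W\<close> held fixed. The integrand sees
  \<open>W\<close> only through \<open>p\<close>, so the same statement covers conditioning on a
  whole history and on the current state alone. Independence is expressed as a product law, which
  lets \<open>W\<close> and \<open>Z\<close> take values in different types.\<close>

lemma (in prob_space) real_cond_exp_indep:
  assumes [measurable]: "W \<in> measurable M N" "Z \<in> measurable M E"
    and indep: "distr M N W \<Otimes>\<^sub>M distr M E Z = distr M (N \<Otimes>\<^sub>M E) (\<lambda>\<omega>. (W \<omega>, Z \<omega>))"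
    and [measurable]: "p \<in> measurable N B"
    and [measurable]: "g \<in> borel_measurable (B \<Otimes>\<^sub>M E)"
    and bound: "\<And>z. \<bar>g z\<bar> \<le> (b::real)"
    and f: "\<And>\<omega>. \<omega> \<in> space M \<Longrightarrow> f \<omega> = g (p (W \<omega>), Z \<omega>)"
  shows "AE \<omega> in M. real_cond_exp M (vimage_algebra (space M) W N) f \<omega> = (\<integral>z. g (p (W \<omega>), z) \<partial>distr M E Z)"
proof -
  let ?F = "vimage_algebra (space M) W N"
  interpret Z: prob_space "distr M E Z" by (rule prob_space_distr) measurable
  interpret W: prob_space "distr M N W" by (rule prob_space_distr) measurable
  interpret WZ: pair_prob_space "distr M N W" "distr M E Z" ..
  have W_space: "W \<in> space M \<rightarrow> space N"
    using measurable_space[OF assms(1)] by auto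
  have sub: "subalgebra M ?F"
    unfolding subalgebra_def using W_space
    by (auto simp: sets_vimage_algebra2)
  interpret F: finite_measure_subalgebra M ?F
    by unfold_locales (rule sub)
  let ?\<phi> = "\<lambda>w. \<integral>z. g (p w, z) \<partial>distr M E Z"
  have \<phi>_meas [measurable]: "?\<phi> \<in> borel_measurable N"
    by measurable
  have \<phi>_bound: "\<bar>?\<phi> w\<bar> \<le> b" if "w \<in> space N" for w
  proof -
    have "integrable (distr M E Z) (\<lambda>z. g (p w, z))"
      using bound that by (intro Z.integrable_const_bound[where B = b]) (auto simp: space_pair_measure)
    then have "norm (?\<phi> w) \<le> (\<integral>z. b \<partial>distr M E Z)"
      using bound by (intro order_trans[OF integral_norm_bound] integral_mono) auto
    then show ?thesis using Z.prob_space by simp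
  qed
  show ?thesis
  proof (rule F.real_cond_exp_charact)
    have "integrable M (\<lambda>\<omega>. g (p (W \<omega>), Z \<omega>))"
      using bound by (intro integrable_const_bound[where B = b]) auto
    then show "integrable M f"
      by (subst Bochner_Integration.integrable_cong[OF refl f])
    show "integrable M (\<lambda>\<omega>. ?\<phi> (W \<omega>))"
      using \<phi>_bound W_space by (intro integrable_const_bound[where B = b]) auto
    show "(\<lambda>\<omega>. ?\<phi> (W \<omega>)) \<in> borel_measurable ?F"
      by (rule measurable_compose[OF measurable_vimage_algebra1[OF W_space] \<phi>_meas])
    fix A assume "A \<in> sets ?F"
    then obtain A' where A' [measurable]: "A' \<in> sets N" and A: "A = W -` A' \<inter> space M"
      using W_space by (auto simp: sets_vimage_algebra2)
    let ?h = "\<lambda>(w, z). indicator A' w * g (p w, z) :: real"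
    have b0: "0 \<le> b" using bound[of undefined] by linarith
    have h_int: "integrable (distr M N W \<Otimes>\<^sub>M distr M E Z) ?h"
      using bound b0 by (intro WZ.integrable_const_bound[where B = b]) (auto simp: indicator_def)
    \<comment> \<open>The integral is moved to the joint law, which factorizes by independence;
      Fubini then integrates over z first and leaves \<open>?\<phi>\<close>.\<close>
    have "(\<integral>\<omega>\<in>A. f \<omega> \<partial>M) = (\<integral>\<omega>. ?h (W \<omega>, Z \<omega>) \<partial>M)"
      unfolding set_lebesgue_integral_def A
      by (intro Bochner_Integration.integral_cong) (auto simp: indicator_def f)
    also have "\<dots> = (\<integral>q. ?h q \<partial>distr M (N \<Otimes>\<^sub>M E) (\<lambda>\<omega>. (W \<omega>, Z \<omega>)))"
      by (intro integral_distr[symmetric]) measurable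
    also have "\<dots> = (\<integral>w. (\<integral>z. ?h (w, z) \<partial>distr M E Z) \<partial>distr M N W)"
      unfolding indep[symmetric] by (intro WZ.integral_fst'[symmetric] h_int)
    also have "\<dots> = (\<integral>w. indicator A' w * ?\<phi> w \<partial>distr M N W)"
      by simp
    also have "\<dots> = (\<integral>\<omega>. indicator A' (W \<omega>) * ?\<phi> (W \<omega>) \<partial>M)"
      by (intro integral_distr) measurable
    also have "\<dots> = (\<integral>\<omega>\<in>A. ?\<phi> (W \<omega>) \<partial>M)"
      unfolding set_lebesgue_integral_def A
      by (intro Bochner_Integration.integral_cong) (auto simp: indicator_def)
    finally show "(\<integral>\<omega>\<in>A. f \<omega> \<partial>M) = (\<integral>\<omega>\<in>A. ?\<phi> (W \<omega>) \<partial>M)" .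
  qed
qed

text \<open>From a deterministic start, unrolling the recursion turns the states up to time k into a
  measurable function of the first k innovations. The history is therefore independent of the next
  innovation, and the freezing lemma applies.\<close>

lemma (in prob_space) markov_chain_recursion:
  fixes Y :: "nat \<Rightarrow> 'a \<Rightarrow> 'b::topological_space" and \<epsilon> :: "nat \<Rightarrow> 'a \<Rightarrow> 'e::topological_space"
  assumes ind: "indep_vars (\<lambda>_. borel) \<epsilon> {1..n}"
    and G: "\<And>k. k < n \<Longrightarrow> G k \<in> measurable (borel \<Otimes>\<^sub>M borel) borel"
    and Y0: "\<And>\<omega>. \<omega> \<in> space M \<Longrightarrow> Y 0 \<omega> = y"
    and YS: "\<And>k \<omega>. k < n \<Longrightarrow> \<omega> \<in> space M \<Longrightarrow> Y (Suc k) \<omega> = G k (Y k \<omega>, \<epsilon> (Suc k) \<omega>)"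
  shows "markov_chain M n Y"
proof -
  \<comment> \<open>The state as a deterministic function of the innovation sequence.
    \<open>R k\<close> reads only the coordinates 1 to k, so it is measurable on the product over
    \<open>{1..K}\<close> for every K between k and n: K = n gives measurability of the states, and
    K = k keeps the history apart from innovation \<open>Suc k\<close>.\<close>
  define R where "R = rec_nat (\<lambda>e::nat \<Rightarrow> 'e. y) (\<lambda>k r e. G k (r e, e (Suc k)))"
  have R_simps: "R 0 e = y" "R (Suc k) e = G k (R k e, e (Suc k))" for k e
    by (simp_all add: R_def)
  have R_meas: "R k \<in> measurable (PiM {1..K} (\<lambda>_. borel)) borel" if "k \<le> K" "K \<le> n" for k K
    using that
  proof (induction k)
    case 0
    then show ?case by (simp add: R_simps[abs_def])
  next
    case (Suc k)
    then have [measurable]: "R k \<in> measurable (PiM {1..K} (\<lambda>_. borel)) borel"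
      and [measurable]: "G k \<in> measurable (borel \<Otimes>\<^sub>M borel) borel"
      and [measurable]: "(\<lambda>e. e (Suc k)) \<in> measurable (PiM {1..K} (\<lambda>_. borel)) borel"
      using G by auto
    show ?case
      unfolding R_simps[abs_def] by measurable
  qed
  have Y_R: "Y k \<omega> = R k (\<lambda>i\<in>{1..K}. \<epsilon> i \<omega>)" if "k \<le> K" "K \<le> n" "\<omega> \<in> space M" for k K \<omega>
    using that by (induction k) (auto simp: R_simps Y0 YS)
  have \<epsilon>_meas: "\<epsilon> i \<in> measurable M borel" if "i \<in> {1..n}" for i
    using ind that by (auto simp: indep_vars_def)
  have Y_meas: "Y k \<in> measurable M borel" if "k \<le> n" for k
  proof -
    have "(\<lambda>\<omega>. R k (\<lambda>i\<in>{1..n}. \<epsilon> i \<omega>)) \<in> measurable M borel"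
      using that \<epsilon>_meas
      by (intro measurable_compose[OF _ R_meas[of k n]] measurable_restrict) auto
    then show ?thesis
      using that Y_R[of k n] by (subst measurable_cong) auto
  qed
  have "AE \<omega> in M.
      real_cond_exp M (vimage_algebra (space M) (\<lambda>\<omega>. \<lambda>i\<in>{..k}. Y i \<omega>) (\<Pi>\<^sub>M i\<in>{..k}. borel))
        (\<lambda>\<omega>. indicator A (Y (Suc k) \<omega>)) \<omega> =
      real_cond_exp M (vimage_algebra (space M) (Y k) borel)
        (\<lambda>\<omega>. indicator A (Y (Suc k) \<omega>)) \<omega>"
    if k: "k < n" and A [measurable]: "A \<in> sets borel" for k A
  proof -
    let ?E = "\<lambda>K. PiM K (\<lambda>_. borel) :: (nat \<Rightarrow> 'e) measure"
    let ?N = "PiM {..k} (\<lambda>_. borel) :: (nat \<Rightarrow> 'b) measure"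
    let ?H = "\<lambda>\<omega>. \<lambda>i\<in>{..k}. Y i \<omega>"
    let ?r = "\<lambda>K \<omega>. \<lambda>i\<in>K. \<epsilon> i \<omega>"
    note [measurable] = G[OF k]
    have \<epsilon>k [measurable]: "\<epsilon> (Suc k) \<in> measurable M borel" and Yk [measurable]: "Y k \<in> measurable M borel"
      using k \<epsilon>_meas[of "Suc k"] Y_meas[of k] by auto
    have H [measurable]: "?H \<in> measurable M ?N"
      using k Y_meas by (intro measurable_restrict) auto
    have hk [measurable]: "(\<lambda>h. h k) \<in> measurable ?N borel"
      by (rule measurable_component_singleton) simp
    have ind0: "indep_var (?E {1..k}) (?r {1..k}) (?E {Suc k}) (?r {Suc k})"
      using k by (intro indep_var_restrict[OF ind]) auto
    have R_hist: "(\<lambda>e. \<lambda>i\<in>{..k}. R i e) \<in> measurable (?E {1..k}) ?N"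
      using k by (intro measurable_restrict R_meas) auto
    have ek: "(\<lambda>e. e (Suc k)) \<in> measurable (?E {Suc k}) borel"
      by (rule measurable_component_singleton) simp
    have r [measurable]: "?r {1..k} \<in> measurable M (?E {1..k})" "?r {Suc k} \<in> measurable M (?E {Suc k})"
      using ind0 by (auto dest: indep_var_rv1 indep_var_rv2)
    \<comment> \<open>Stated for an arbitrary measurable function \<open>q\<close> of the history:
      the identity gives the full history, evaluation at k gives the current state.\<close>
    have joint: "distr M N W \<Otimes>\<^sub>M distr M borel (\<epsilon> (Suc k))
        = distr M (N \<Otimes>\<^sub>M borel) (\<lambda>\<omega>. (W \<omega>, \<epsilon> (Suc k) \<omega>))"
      if q: "q \<in> measurable ?N N" and W: "\<And>\<omega>. \<omega> \<in> space M \<Longrightarrow> W \<omega> = q (?H \<omega>)"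
      for q N and W :: "'a \<Rightarrow> 'n"
    proof -
      let ?v = "\<lambda>e. q (\<lambda>i\<in>{..k}. R i e)"
      have v [measurable]: "?v \<in> measurable (?E {1..k}) N"
        by (rule measurable_compose[OF R_hist q])
      have V: "?v (?r {1..k} \<omega>) = W \<omega>" if "\<omega> \<in> space M" for \<omega>
      proof -
        have "(\<lambda>i\<in>{..k}. R i (?r {1..k} \<omega>)) = ?H \<omega>"
          using k that by (intro restrict_ext) (simp add: Y_R[of _ k])
        then show ?thesis using W[OF that] by simp
      qed
      interpret \<epsilon>k: prob_space "distr M borel (\<epsilon> (Suc k))"
        by (rule prob_space_distr) measurable
      have W1: "distr (distr M (?E {1..k}) (?r {1..k})) N ?v = distr M N W"
        unfolding distr_distr[OF v r(1)] by (rule distr_cong) (simp_all add: V del: One_nat_def)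
      have \<epsilon>1: "distr (distr M (?E {Suc k}) (?r {Suc k})) borel (\<lambda>e. e (Suc k)) = distr M borel (\<epsilon> (Suc k))"
        unfolding distr_distr[OF ek r(2)] by (simp add: o_def)
      have "distr M N W \<Otimes>\<^sub>M distr M borel (\<epsilon> (Suc k))
          = distr (distr M (?E {1..k}) (?r {1..k}) \<Otimes>\<^sub>M distr M (?E {Suc k}) (?r {Suc k}))
              (N \<Otimes>\<^sub>M borel) (\<lambda>(e, e'). (?v e, e' (Suc k)))"
        using \<epsilon>k.sigma_finite_measure_axioms ek v
        by (subst pair_measure_distr[symmetric]) (simp_all add: W1 \<epsilon>1 del: One_nat_def)
      also have "\<dots> = distr (distr M (?E {1..k} \<Otimes>\<^sub>M ?E {Suc k}) (\<lambda>\<omega>. (?r {1..k} \<omega>, ?r {Suc k} \<omega>)))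
              (N \<Otimes>\<^sub>M borel) (\<lambda>(e, e'). (?v e, e' (Suc k)))"
        using ind0 unfolding indep_var_distribution_eq by simp
      also have "\<dots> = distr M (N \<Otimes>\<^sub>M borel) (\<lambda>\<omega>. (W \<omega>, \<epsilon> (Suc k) \<omega>))"
        using ek v by (subst distr_distr) (simp_all add: V o_def del: One_nat_def cong: distr_cong)
      finally show ?thesis .
    qed
    let ?g = "\<lambda>z. indicator A (G k z) :: real"
    let ?f = "\<lambda>\<omega>. indicator A (Y (Suc k) \<omega>) :: real"
    have g: "?g \<in> borel_measurable (borel \<Otimes>\<^sub>M borel)"
      by measurable
    \<comment> \<open>Here \<open>p\<close> is evaluation of the history at k; in the second
      application it is the identity. Both right-hand sides are the same integral, because the
      history evaluated at k is \<open>Y k\<close>.\<close>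
    have "AE \<omega> in M. real_cond_exp M (vimage_algebra (space M) ?H ?N) ?f \<omega>
        = (\<integral>z. ?g (?H \<omega> k, z) \<partial>distr M borel (\<epsilon> (Suc k)))"
      by (rule real_cond_exp_indep[OF H \<epsilon>k _ hk g, where b = 1])
        (auto simp: YS[OF k] indicator_def intro!: joint[of "\<lambda>h. h"])
    moreover have "AE \<omega> in M. real_cond_exp M (vimage_algebra (space M) (Y k) borel) ?f \<omega>
        = (\<integral>z. ?g (Y k \<omega>, z) \<partial>distr M borel (\<epsilon> (Suc k)))"
      by (rule real_cond_exp_indep[OF Yk \<epsilon>k _ measurable_ident_sets[OF refl] g, where b = 1])
        (auto simp: YS[OF k] indicator_def intro!: joint[of "\<lambda>h. h k"] hk)
    ultimately show ?thesis by eventually_elim simp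
  qed
  then show ?thesis
    unfolding markov_chain_def using Y_meas prob_space_axioms by auto
qed

section \<open>Jacobians and Euler broken lines\<close>

lemma bounded_bilinear_matrix_vector_mult:
  "bounded_bilinear (\<lambda>(A :: real ^ 'n ^ 'm) v. A *v v)"
  unfolding bilinear_conv_bounded_bilinear[symmetric] bilinear_def
  by (auto intro!: linearI simp: matrix_vector_mult_def vec_eq_iff sum.distrib sum_distrib_left
      algebra_simps)

lemma bounded_bilinear_matrix_matrix_mult:
  "bounded_bilinear (\<lambda>(A :: real ^ 'n ^ 'm) (B :: real ^ 'k ^ 'n). A ** B)"
  unfolding bilinear_conv_bounded_bilinear[symmetric] bilinear_def
  by (auto intro!: linearI simp: matrix_matrix_mult_def vec_eq_iff sum.distrib sum_distrib_left
      algebra_simps)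

text \<open>The columns of the Jacobian are derivatives in unit directions, so each entry is at most
  \<open>c\<close> in absolute value; the factor counts the d^2 entries.\<close>

lemma norm_jacobian_le:
  fixes f :: "real ^ 'd \<Rightarrow> real ^ 'd"
  assumes f: "f differentiable at y" and lip: "\<And>x z. norm (f x - f z) \<le> c * norm (x - z)"
  shows "norm (jacobian f (at y)) \<le> (real CARD('d))\<^sup>2 * c"
proof -
  have "\<bar>jacobian f (at y) $ i $ j\<bar> \<le> c" for i j
  proof -
    have D: "(f has_derivative frechet_derivative f (at y)) (at y)"
      using f frechet_derivative_works by blast
    have "\<bar>jacobian f (at y) $ i $ j\<bar> \<le> norm (frechet_derivative f (at y) (axis j 1))"
      by (simp add: jacobian_def matrix_def component_le_norm_cart)
    also have "\<dots> \<le> c"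
      using norm_derivative_le[OF D lip, of "axis j 1"] by simp
    finally show ?thesis .
  qed
  then have "norm (jacobian f (at y) $ i) \<le> real CARD('d) * c" for i
    using sum_bounded_above[of UNIV "\<lambda>j. \<bar>jacobian f (at y) $ i $ j\<bar>" c]
    by (intro order_trans[OF norm_le_l1_cart]) simp
  then have "(\<Sum>i\<in>UNIV. norm (jacobian f (at y) $ i)) \<le> real CARD('d) * (real CARD('d) * c)"
    using sum_bounded_above[of UNIV "\<lambda>i. norm (jacobian f (at y) $ i)"] by simp
  then show ?thesis
    unfolding norm_vec_def[of "jacobian f (at y)"]
    by (intro order_trans[OF L2_set_le_sum]) (auto simp: power2_eq_square)
qed

lemma C2_on_differentiable:
  assumes "C2_on UNIV f"
  shows "f differentiable at y"
  using C2_onE[OF assms] differentiableI by metis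

lemma continuous_on_jacobian:
  fixes f :: "real ^ 'd \<Rightarrow> real ^ 'd"
  assumes "C2_on UNIV f"
  shows "continuous_on UNIV (\<lambda>y. jacobian f (at y))"
proof -
  obtain f' where f: "\<And>x. (f has_derivative blinfun_apply (f' x)) (at x)" "continuous_on UNIV f'"
    using C2_onE[OF assms] by metis
  have "jacobian f (at y) = (\<chi> i j. f' y (axis j 1) $ i)" for y
    unfolding jacobian_def matrix_def frechet_derivative_at[OF f(1), symmetric] ..
  moreover have "continuous_on UNIV (\<lambda>y. \<chi> i j. f' y (axis j 1) $ i)"
    by (intro continuous_on_vec_lambda continuous_on_component blinfun.continuous_on f(2)
        continuous_on_const)
  ultimately show ?thesis by simp
qed

lemma continuous_on_jacobian_segment:
  fixes f :: "real ^ 'd \<Rightarrow> real ^ 'd"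
  assumes "C2_on UNIV f"
  shows "continuous_on S (\<lambda>u. jacobian f (at (p + u *\<^sub>R q)))"
  by (rule continuous_on_compose2[OF continuous_on_jacobian[OF assms]])
    (auto intro!: continuous_intros)

text \<open>The fundamental theorem of calculus along the segment from \<open>p\<close> to
  \<open>p + q\<close>. The matrix is integrated before it acts on \<open>q\<close>, as in
  \<open>m_tilde\<close> and \<open>sigma_tilde\<close>; this is legitimate because evaluation at
  \<open>q\<close> is bounded linear and commutes with the integral.\<close>

lemma integral_jacobian_segment:
  fixes f :: "real ^ 'd \<Rightarrow> real ^ 'd"
  assumes C2: "C2_on UNIV f"
  shows "integral {0..1} (\<lambda>u. jacobian f (at (p + u *\<^sub>R q))) *v q = f (p + q) - f p"
proof -
  have lin: "bounded_linear (\<lambda>A :: real ^ 'd ^ 'd. A *v q)"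
    by (rule bounded_bilinear.bounded_linear_left[OF bounded_bilinear_matrix_vector_mult])
  have "((\<lambda>u. f (p + u *\<^sub>R q)) has_vector_derivative (jacobian f (at (p + u *\<^sub>R q)) *v q))
      (at u within {0..1})" for u
  proof -
    have 1: "((\<lambda>u. p + u *\<^sub>R q) has_derivative (\<lambda>r. r *\<^sub>R q)) (at u within {0..1})"
      by (auto intro!: derivative_eq_intros)
    have 2: "(f has_derivative (\<lambda>h. jacobian f (at (p + u *\<^sub>R q)) *v h)) (at (p + u *\<^sub>R q))"
      using C2_on_differentiable[OF C2] jacobian_works by blast
    show ?thesis
      using has_derivative_compose[OF 1 2]
      by (simp add: has_vector_derivative_def matrix_vector_mult_scaleR)
  qed
  then have 1: "((\<lambda>u. jacobian f (at (p + u *\<^sub>R q)) *v q) has_integral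
      (f (p + 1 *\<^sub>R q) - f (p + 0 *\<^sub>R q))) {0..1}"
    by (intro fundamental_theorem_of_calculus) auto
  have "((\<lambda>u. jacobian f (at (p + u *\<^sub>R q))) has_integral
      integral {0..1} (\<lambda>u. jacobian f (at (p + u *\<^sub>R q)))) {0..1}"
    by (intro integrable_integral integrable_continuous_interval continuous_on_jacobian_segment C2)
  from has_integral_linear[OF this lin]
  have 2: "((\<lambda>u. jacobian f (at (p + u *\<^sub>R q)) *v q) has_integral
      integral {0..1} (\<lambda>u. jacobian f (at (p + u *\<^sub>R q))) *v q) {0..1}"
    by (simp add: o_def)
  show ?thesis
    using has_integral_unique[OF 2 1] by simp
qed

lemma norm_integral_jacobian_le:
  fixes f :: "real ^ 'd \<Rightarrow> real ^ 'd"
  assumes C2: "C2_on UNIV f" and lip: "\<And>x z. norm (f x - f z) \<le> c * norm (x - z)"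
  shows "norm (integral {0..1} (\<lambda>u. jacobian f (at (p + u *\<^sub>R q)))) \<le> (real CARD('d))\<^sup>2 * c"
  using integral_bound[OF _ continuous_on_jacobian_segment[OF C2], of 0 1 p q]
    norm_jacobian_le[OF C2_on_differentiable[OF C2] lip] by simp

text \<open>Expanding a direction in the standard basis bounds the derivative by d times the bound
  on the partial derivatives; the mean value inequality on the whole space does the rest.\<close>

lemma lipschitz_of_partial_bound:
  fixes f :: "real ^ 'd \<Rightarrow> real ^ 'd"
  assumes C2: "C2_on UNIV f" and b: "\<And>y i. norm (multi_diff [i] f y) \<le> b"
  shows "norm (f y - f z) \<le> (real CARD('d) * b) * norm (y - z)"
proof -
  obtain f' where f': "\<And>x. (f has_derivative blinfun_apply (f' x)) (at x)"
    using C2_onE[OF C2] by metis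
  have ax: "norm (f' y (axis i 1)) \<le> b" for y i
  proof -
    have 1: "((\<lambda>r. y + r *\<^sub>R axis i 1) has_derivative (\<lambda>r. r *\<^sub>R axis i 1)) (at 0)"
      by (auto intro!: derivative_eq_intros)
    have 2: "(f has_derivative f' y) (at (y + 0 *\<^sub>R axis i 1))"
      using f' by simp
    have "((\<lambda>r. f (y + r *\<^sub>R axis i 1)) has_vector_derivative f' y (axis i 1)) (at 0)"
      using has_derivative_compose[OF 1 2]
      by (simp add: has_vector_derivative_def blinfun.scaleR_right)
    then have "multi_diff [i] f y = f' y (axis i 1)"
      by (simp add: partial_diff_def vector_derivative_at)
    then show ?thesis using b[of i y] by simp
  qed
  have "norm (f' y v) \<le> (real CARD('d) * b) * norm v" for y v
  proof -
    have "f' y v = (\<Sum>i\<in>UNIV. v $ i *\<^sub>R f' y (axis i 1))"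
      by (subst basis_expansion[of v, symmetric])
        (simp add: blinfun.sum_right blinfun.scaleR_right scalar_mult_eq_scaleR)
    also have "norm \<dots> \<le> (\<Sum>i\<in>(UNIV :: 'd set). norm v * b)"
      using ax by (intro sum_norm_le) (auto intro!: mult_mono component_le_norm_cart)
    finally show ?thesis by (simp add: mult_ac)
  qed
  then have "onorm (f' y) \<le> real CARD('d) * b" for y
    by (intro onorm_le)
  then show ?thesis
    using differentiable_bound[of UNIV f "\<lambda>x. blinfun_apply (f' x)" "real CARD('d) * b" y z] f'
    by simp
qed

section \<open>Euler steps as perturbations of the identity\<close>

text \<open>Solving y = x + f x means finding a fixed point of the contraction sending x to y - f
  x.\<close>

lemma surj_ident_plus_contraction:
  fixes f :: "'a::banach \<Rightarrow> 'a"
  assumes lip: "\<And>x y. norm (f x - f y) \<le> c * norm (x - y)" and c: "0 \<le> c" "c < 1"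
  shows "surj (\<lambda>x. x + f x)"
proof -
  have "\<exists>x. y = x + f x" for y
  proof -
    have "\<exists>!x. y - f x = x"
      using lip by (intro banach_fix_type[OF c]) (auto simp: dist_norm norm_minus_commute)
    then show ?thesis by (metis diff_add_cancel)
  qed
  then show ?thesis by (simp add: surj_def)
qed

text \<open>For \<open>a \<le> 1/2\<close> one has \<open>1 / (1 - a) \<le> exp (2 a)\<close>, so the expansion constants of the
  successive Euler steps multiply up to \<open>exp (2 L \<tau>\<^sub>k)\<close>, uniformly over all partitions.\<close>

lemma ghat_bilipschitz:
  assumes C2: "\<And>k. k < n \<Longrightarrow> C2_on UNIV (F (\<tau> k))"
    and lip: "\<And>k y z. k < n \<Longrightarrow> norm (F (\<tau> k) y - F (\<tau> k) z) \<le> L * norm (y - z)"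
    and step: "\<And>k. k < n \<Longrightarrow> 0 \<le> step \<tau> k" "\<And>k. k < n \<Longrightarrow> L * step \<tau> k \<le> 1 / 2"
    and L: "0 \<le> L" and k: "k \<le> n"
  shows "C2_on UNIV (ghat F \<tau> k) \<and> surj (ghat F \<tau> k) \<and>
    (\<forall>y z. norm (y - z) \<le> exp (2 * L * (\<tau> k - \<tau> 0)) * norm (ghat F \<tau> k y - ghat F \<tau> k z))"
  using k
proof (induction k)
  case 0
  then show ?case
    using C2_on_ident by (simp add: surj_def)
next
  case (Suc k)
  let ?h = "step \<tau> k" and ?g = "ghat F \<tau> k"
  let ?\<phi> = "\<lambda>y. y + ?h *\<^sub>R F (\<tau> k) y"
  have k: "k < n" using Suc.prems by simp
  have IH: "C2_on UNIV ?g" "surj ?g"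
      "\<And>y z. norm (y - z) \<le> exp (2 * L * (\<tau> k - \<tau> 0)) * norm (?g y - ?g z)"
    using Suc by auto
  have eq: "ghat F \<tau> (Suc k) = (\<lambda>y. ?\<phi> (?g y))"
    by auto
  have hlip: "norm (?h *\<^sub>R F (\<tau> k) y - ?h *\<^sub>R F (\<tau> k) z) \<le> (L * ?h) * norm (y - z)" for y z
    using mult_left_mono[OF lip[OF k] step(1)[OF k], of y z]
    by (simp add: scaleR_diff_right[symmetric] step(1)[OF k] mult_ac)
  have exp: "norm (y - z) \<le> exp (2 * L * ?h) * norm (?\<phi> y - ?\<phi> z)" for y z
  proof -
    let ?a = "L * ?h"
    have a: "0 \<le> ?a" "?a \<le> 1 / 2"
      using L step[OF k] by auto
    have "norm (y - z) = norm ((?\<phi> y - ?\<phi> z) - (?h *\<^sub>R F (\<tau> k) y - ?h *\<^sub>R F (\<tau> k) z))"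
      by (simp add: algebra_simps)
    also have "\<dots> \<le> norm (?\<phi> y - ?\<phi> z) + ?a * norm (y - z)"
      using norm_triangle_ineq4 hlip[of y z] by (meson add_left_mono order_trans)
    finally have 1: "(1 - ?a) * norm (y - z) \<le> norm (?\<phi> y - ?\<phi> z)"
      by (simp add: algebra_simps)
    \<comment> \<open>From a <= 1/2 follows a^2 <= a/2, hence (1 + 2a)(1 - a) = 1 + a - 2a^2 >= 1,
      and 1 + 2a <= exp (2a).\<close>
    have "?a * ?a \<le> ?a * (1 / 2)"
      using a by (intro mult_left_mono)
    then have "1 \<le> (1 + 2 * ?a) * (1 - ?a)"
      by (simp add: algebra_simps)
    also have "\<dots> \<le> exp (2 * L * ?h) * (1 - ?a)"
      using exp_ge_add_one_self[of "2 * L * ?h"] a by (intro mult_right_mono) (auto simp: mult.assoc)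
    finally have "1 * norm (y - z) \<le> (exp (2 * L * ?h) * (1 - ?a)) * norm (y - z)"
      by (rule mult_right_mono) simp
    also have "\<dots> \<le> exp (2 * L * ?h) * norm (?\<phi> y - ?\<phi> z)"
      using 1 by (simp add: mult.assoc)
    finally show ?thesis by simp
  qed
  have "surj ?\<phi>"
    using step[OF k] L by (intro surj_ident_plus_contraction[OF hlip]) auto
  then have "surj (ghat F \<tau> (Suc k))"
    unfolding eq using comp_surj[OF IH(2)] by (simp only: o_def)
  moreover have "C2_on UNIV (ghat F \<tau> (Suc k))"
    unfolding eq
    by (rule C2_on_compose[OF IH(1) C2_on_add[OF C2_on_ident C2_on_scaleR[OF C2[OF k]]]])
  moreover have "norm (y - z) \<le> exp (2 * L * (\<tau> (Suc k) - \<tau> 0))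
      * norm (ghat F \<tau> (Suc k) y - ghat F \<tau> (Suc k) z)" for y z
  proof -
    have "norm (y - z) \<le> exp (2 * L * (\<tau> k - \<tau> 0)) * (exp (2 * L * ?h) * norm (?\<phi> (?g y) - ?\<phi> (?g z)))"
      by (rule order_trans[OF IH(3) mult_left_mono[OF exp]]) simp
    also have "\<dots> = exp (2 * L * (\<tau> (Suc k) - \<tau> 0)) * norm (?\<phi> (?g y) - ?\<phi> (?g z))"
    proof -
      have "2 * L * (\<tau> k - \<tau> 0) + 2 * L * ?h = 2 * L * (\<tau> (Suc k) - \<tau> 0)"
        by (simp add: step_def algebra_simps)
      then show ?thesis by (simp only: mult.assoc[symmetric] exp_add[symmetric])
    qed
    finally show ?thesis by simp
  qed
  ultimately show ?case by blast
qed

section \<open>Bounds and increments for the transformed coefficients\<close>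

text \<open>Tested on the i-th unit vector, the quadratic form of A A^T is the squared norm of the
  i-th row of \<open>A\<close>. Each row thus has norm at most the square root of
  \<open>\<Lambda>\<close>, and there are d rows.\<close>

lemma norm_le_of_elliptic:
  fixes A :: "real ^ 'd ^ 'd"
  assumes "\<And>\<xi>. ((A ** transpose A) *v \<xi>) \<bullet> \<xi> \<le> \<Lambda> * (norm \<xi>)\<^sup>2"
  shows "norm A \<le> real CARD('d) * sqrt \<Lambda>"
proof -
  have "norm (A $ i) \<le> sqrt \<Lambda>" for i
  proof -
    have "transpose A *v axis i 1 = A $ i"
      by (simp add: matrix_vector_mult_basis column_transpose row_def)
    moreover have "((A ** transpose A) *v axis i 1) \<bullet> axis i 1
        = (transpose A *v axis i 1) \<bullet> (transpose A *v axis i 1)"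
      by (metis dot_lmul_matrix inner_commute matrix_vector_mul_assoc transpose_matrix_vector)
    ultimately have "(norm (A $ i))\<^sup>2 \<le> \<Lambda>"
      using assms[of "axis i 1"] by (simp add: power2_norm_eq_inner)
    then show ?thesis by (rule real_le_rsqrt)
  qed
  then have "(\<Sum>i\<in>UNIV. norm (A $ i)) \<le> real CARD('d) * sqrt \<Lambda>"
    using sum_bounded_above[of UNIV "\<lambda>i. norm (A $ i)"] by simp
  then show ?thesis
    unfolding norm_vec_def[of A] by (intro order_trans[OF L2_set_le_sum]) auto
qed

lemma borel_measurable_matrix_vector_mult [measurable (raw)]:
  fixes A :: "'a \<Rightarrow> real ^ 'n ^ 'm"
  assumes "A \<in> borel_measurable M" "v \<in> borel_measurable M"
  shows "(\<lambda>\<omega>. A \<omega> *v v \<omega>) \<in> borel_measurable M"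
  by (rule borel_measurable_continuous_Pair[OF assms])
    (intro bounded_bilinear.continuous_on[OF bounded_bilinear_matrix_vector_mult] continuous_intros)

text \<open>The next state splits as \<open>?p + q\<close>: the deterministic step \<open>?p\<close>
  absorbs \<open>F\<close>, while \<open>q\<close> carries \<open>m\<close> and the noise. The
  inverse flow sends \<open>?p\<close> back to \<open>y\<close>, so \<open>F\<close> disappears, and
  the increment is linear in \<open>q\<close>, which separates the two transformed
  coefficients.\<close>

lemma tilde_increment:
  fixes F m :: "real \<Rightarrow> real ^ 'd \<Rightarrow> real ^ 'd"
  assumes C2: "C2_on UNIV (ghat_inv F \<tau> (Suc k))" and inj: "inj (ghat F \<tau> (Suc k))"
  shows "ghat_inv F \<tau> (Suc k) (ghat F \<tau> k y
        + step \<tau> k *\<^sub>R (F (\<tau> k) (ghat F \<tau> k y) + m (\<tau> k) (ghat F \<tau> k y))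
        + sqrt (step \<tau> k) *\<^sub>R (\<sigma> (\<tau> k) (ghat F \<tau> k y) *v e)) =
      y + step \<tau> k *\<^sub>R m_tilde F m \<sigma> \<tau> k y e
        + sqrt (step \<tau> k) *\<^sub>R (sigma_tilde F m \<sigma> \<tau> k y e *v e)"
proof -
  let ?p = "ghat F \<tau> (Suc k) y"
  define q where "q = step \<tau> k *\<^sub>R m (\<tau> k) (ghat F \<tau> k y)
      + sqrt (step \<tau> k) *\<^sub>R (\<sigma> (\<tau> k) (ghat F \<tau> k y) *v e)"
  define I where "I = integral {0..1} (\<lambda>u. ghat_inv_jac F \<tau> (Suc k) (?p + u *\<^sub>R q))"
  have Psi: "Psi F m \<sigma> \<tau> k u y e = ?p + u *\<^sub>R q" for u
    by (simp add: Psi_def q_def scaleR_add_right)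
  have "step \<tau> k *\<^sub>R m_tilde F m \<sigma> \<tau> k y e
      + sqrt (step \<tau> k) *\<^sub>R (sigma_tilde F m \<sigma> \<tau> k y e *v e) = I *v q"
    unfolding m_tilde_def sigma_tilde_def Psi I_def[symmetric]
    by (simp add: q_def matrix_vector_right_distrib matrix_vector_mult_scaleR
        matrix_vector_mul_assoc[symmetric])
  also have "\<dots> = ghat_inv F \<tau> (Suc k) (?p + q) - ghat_inv F \<tau> (Suc k) ?p"
    unfolding I_def ghat_inv_jac_def by (rule integral_jacobian_segment[OF C2])
  also have "ghat_inv F \<tau> (Suc k) ?p = y"
    by (rule inv_f_f[OF inj])
  finally have "ghat_inv F \<tau> (Suc k) (?p + q) = y + (step \<tau> k *\<^sub>R m_tilde F m \<sigma> \<tau> k y e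
      + sqrt (step \<tau> k) *\<^sub>R (sigma_tilde F m \<sigma> \<tau> k y e *v e))"
    by (simp only: algebra_simps)
  moreover have "?p + q = ghat F \<tau> k y
        + step \<tau> k *\<^sub>R (F (\<tau> k) (ghat F \<tau> k y) + m (\<tau> k) (ghat F \<tau> k y))
        + sqrt (step \<tau> k) *\<^sub>R (\<sigma> (\<tau> k) (ghat F \<tau> k y) *v e)"
    by (simp add: q_def scaleR_add_right)
  ultimately show ?thesis
    by (simp only: add.assoc)
qed

text \<open>\<open>Psi\<close> is affine in u, and the Lipschitz bound controls the Jacobian at
  every point of space, so the estimate is uniform in \<open>y\<close> and in the unbounded noise
  value \<open>e\<close>.\<close>

lemma norm_ghat_inv_jac_integral_le:
  fixes F m :: "real \<Rightarrow> real ^ 'd \<Rightarrow> real ^ 'd"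
  assumes C2: "C2_on UNIV (ghat_inv F \<tau> (Suc k))"
    and lip: "\<And>y z. norm (ghat_inv F \<tau> (Suc k) y - ghat_inv F \<tau> (Suc k) z) \<le> c * norm (y - z)"
  shows "norm (integral {0..1} (\<lambda>u. ghat_inv_jac F \<tau> (Suc k) (Psi F m \<sigma> \<tau> k u y e)))
    \<le> (real CARD('d))\<^sup>2 * c"
proof -
  let ?p = "ghat F \<tau> (Suc k) y"
  let ?q = "step \<tau> k *\<^sub>R m (\<tau> k) (ghat F \<tau> k y)
      + sqrt (step \<tau> k) *\<^sub>R (\<sigma> (\<tau> k) (ghat F \<tau> k y) *v e)"
  have "Psi F m \<sigma> \<tau> k u y e = ?p + u *\<^sub>R ?q" for u
    by (simp add: Psi_def scaleR_add_right)
  then show ?thesis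
    unfolding ghat_inv_jac_def using norm_integral_jacobian_le[OF C2 lip, of ?p ?q] by (simp only:)
qed

theorem mainTheorem2:
  fixes T :: real
    and F m :: "real \<Rightarrow> real ^ 'd \<Rightarrow> real ^ 'd"
    and \<sigma> :: "real \<Rightarrow> real ^ 'd \<Rightarrow> real ^ 'd ^ 'd"
    and t :: "nat \<Rightarrow> nat \<Rightarrow> real"
    and x :: "real ^ 'd"
    and M :: "nat \<Rightarrow> 'w measure"
    and \<epsilon> X :: "nat \<Rightarrow> nat \<Rightarrow> 'w \<Rightarrow> real ^ 'd"
  assumes T_pos: "T > 0"
    and sigma_measurable: "\<And>s. s \<in> {0..T} \<Longrightarrow> \<sigma> s \<in> borel_measurable borel"
    and elliptic: "\<exists>\<Lambda>\<ge>1. \<forall>s\<in>{0..T}. \<forall>y \<xi>.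
          inverse \<Lambda> * (norm \<xi>)\<^sup>2 \<le> ((\<sigma> s y ** transpose (\<sigma> s y)) *v \<xi>) \<bullet> \<xi> \<and>
          ((\<sigma> s y ** transpose (\<sigma> s y)) *v \<xi>) \<bullet> \<xi> \<le> \<Lambda> * (norm \<xi>)\<^sup>2"
    and F_C2: "C2_on ({0..T} \<times> UNIV) (\<lambda>(s, y). F s y)"
    and F_bound: "\<exists>M_F. \<forall>s\<in>{0..T}. \<forall>y. \<forall>\<nu>. length \<nu> \<in> {1, 2} \<longrightarrow>
          norm (multi_diff \<nu> (F s) y) \<le> M_F"
    and m_cont: "continuous_on ({0..T} \<times> UNIV) (\<lambda>(s, y). m s y)"
    and m_bounded: "bounded ((\<lambda>(s, y). m s y) ` ({0..T} \<times> UNIV))"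
    and t_start: "\<And>n. n \<ge> 1 \<Longrightarrow> t n 0 = 0"
    and t_end: "\<And>n. n \<ge> 1 \<Longrightarrow> t n n = T"
    and t_less: "\<And>n k. n \<ge> 1 \<Longrightarrow> k < n \<Longrightarrow> t n k < t n (Suc k)"
    and step_ratio: "\<exists>C>1. \<forall>n\<ge>1. \<forall>k<n. \<forall>l<n.
          inverse C \<le> step (t n) k / step (t n) l \<and> step (t n) k / step (t n) l \<le> C"
    and step_lim: "(\<lambda>n. step (t n) 1) \<longlonglongrightarrow> 0"
    and prob: "\<And>n. n \<ge> 1 \<Longrightarrow> prob_space (M n)"
    and innovations: "\<And>n. n \<ge> 1 \<Longrightarrow> prob_space.indep_vars (M n) (\<lambda>_. borel) (\<epsilon> n) {1..n}"
    and X_start: "\<And>n \<omega>. n \<ge> 1 \<Longrightarrow> \<omega> \<in> space (M n) \<Longrightarrow> X n 0 \<omega> = x"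
    and X_step: "\<And>n k \<omega>. n \<ge> 1 \<Longrightarrow> k < n \<Longrightarrow> \<omega> \<in> space (M n) \<Longrightarrow>
          X n (Suc k) \<omega> = X n k \<omega>
            + step (t n) k *\<^sub>R (F (t n k) (X n k \<omega>) + m (t n k) (X n k \<omega>))
            + sqrt (step (t n) k) *\<^sub>R (\<sigma> (t n k) (X n k \<omega>) *v \<epsilon> n (Suc k) \<omega>)"
  shows "(\<forall>\<^sub>F n in sequentially.
            (\<forall>k\<le>n. C2_diffeomorphism (ghat F (t n) k)) \<and>
            markov_chain (M n) n (\<lambda>k \<omega>. ghat_inv F (t n) k (X n k \<omega>)) \<and>
            (\<forall>k<n. \<forall>\<omega>\<in>space (M n).
               ghat_inv F (t n) (Suc k) (X n (Suc k) \<omega>) =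
                 ghat_inv F (t n) k (X n k \<omega>)
                 + step (t n) k *\<^sub>R
                     m_tilde F m \<sigma> (t n) k (ghat_inv F (t n) k (X n k \<omega>)) (\<epsilon> n (Suc k) \<omega>)
                 + sqrt (step (t n) k) *\<^sub>R
                     (sigma_tilde F m \<sigma> (t n) k (ghat_inv F (t n) k (X n k \<omega>)) (\<epsilon> n (Suc k) \<omega>)
                      *v \<epsilon> n (Suc k) \<omega>))) \<and>
         (\<exists>C'. \<forall>\<^sub>F n in sequentially. \<forall>k<n. \<forall>y e.
            norm (m_tilde F m \<sigma> (t n) k y e) \<le> C' \<and>
            norm (sigma_tilde F m \<sigma> (t n) k y e) \<le> C')"
proof -
  obtain \<Lambda> where \<Lambda>: "\<And>s y \<xi>. s \<in> {0..T} \<Longrightarrow>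
      ((\<sigma> s y ** transpose (\<sigma> s y)) *v \<xi>) \<bullet> \<xi> \<le> \<Lambda> * (norm \<xi>)\<^sup>2"
    using elliptic by blast
  obtain M_F where M_F: "\<And>s y \<nu>. s \<in> {0..T} \<Longrightarrow> length \<nu> \<in> {1, 2} \<Longrightarrow> norm (multi_diff \<nu> (F s) y) \<le> M_F"
    using F_bound by blast
  obtain M_m where M_m: "\<And>s y. s \<in> {0..T} \<Longrightarrow> norm (m s y) \<le> M_m"
    using m_bounded unfolding bounded_iff by force
  \<comment> \<open>The reference step has index 1 because the mesh hypothesis concerns that index;
    it belongs to the partition only if n is at least 2, hence the condition 1 < n.\<close>
  obtain C where C: "\<And>n k. n \<ge> 1 \<Longrightarrow> k < n \<Longrightarrow> 1 < n \<Longrightarrow> step (t n) k / step (t n) 1 \<le> C"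
    using step_ratio by blast
  \<comment> \<open>\<open>L\<close> is a Lipschitz constant of every \<open>F s\<close> on the time
    interval, from the bound on first partial derivatives. \<open>E\<close> dominates all the
    expansion constants of the flows, since every partition point is at most T.\<close>
  define L where "L = real CARD('d) * M_F"
  define E where "E = exp (2 * L * T)"
  have F_C2s: "C2_on UNIV (F s)" if "s \<in> {0..T}" for s
    by (rule C2_on_slice[OF F_C2 that])
  have F_lip: "norm (F s y - F s z) \<le> L * norm (y - z)" if "s \<in> {0..T}" for s y z
    unfolding L_def by (rule lipschitz_of_partial_bound[OF F_C2s[OF that] M_F[OF that]]) simp
  \<comment> \<open>Nonnegativity is read off from one instance of the bound, at time 0 and an
    arbitrary coordinate.\<close>
  have M_F0: "0 \<le> M_F"
    using order_trans[OF norm_ge_zero M_F[of 0 "[undefined]"]] T_pos by simp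
  then have L0: "0 \<le> L" by (simp add: L_def)
  have step_pos: "0 < step (t n) k" if "n \<ge> 1" "k < n" for n k
    using t_less[OF that] by (simp add: step_def)
  have t_mono: "t n i \<le> t n j" if "n \<ge> 1" "i \<le> j" "j \<le> n" for n i j
    using that(2,3)
  proof (induction rule: dec_induct)
    case (step k)
    then show ?case using t_less[OF that(1), of k] by simp
  qed simp
  have t_range: "t n k \<in> {0..T}" if "n \<ge> 1" "k \<le> n" for n k
    using t_mono[of n 0 k] t_mono[of n k n] t_start t_end that by simp

  \<comment> \<open>The step of index 1 tends to 0, and the ratio bound transfers this to all steps
    of the partition simultaneously.\<close>
  have "\<forall>\<^sub>F n in sequentially. L * (C * step (t n) 1) < 1 / 2"
    using tendsto_mult_left[OF tendsto_mult_left[OF step_lim, of C], of L]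
    by (intro order_tendstoD(2)) auto
  then have small: "\<forall>\<^sub>F n in sequentially. 1 < n \<and> (\<forall>k<n. L * step (t n) k \<le> 1 / 2)"
    using eventually_gt_at_top[of 1]
  proof eventually_elim
    case (elim n)
    have "L * step (t n) k \<le> 1 / 2" if "k < n" for k
    proof -
      have "step (t n) k \<le> C * step (t n) 1"
        using C[of n k] step_pos[of n 1] elim that by (simp add: pos_divide_le_eq)
      then have "L * step (t n) k \<le> L * (C * step (t n) 1)"
        using L0 by (rule mult_left_mono)
      then show ?thesis using elim by simp
    qed
    then show ?case using elim by blast
  qed

  have ghat: "C2_diffeomorphism (ghat F (t n) k) \<and>
      (\<forall>y z. norm (ghat_inv F (t n) k y - ghat_inv F (t n) k z) \<le> E * norm (y - z))"
    if n: "1 < n" and h: "\<And>k. k < n \<Longrightarrow> L * step (t n) k \<le> 1 / 2" and k: "k \<le> n" for n k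
  proof -
    have g: "C2_on UNIV (ghat F (t n) k)" "surj (ghat F (t n) k)"
        "\<And>y z. norm (y - z) \<le> exp (2 * L * (t n k - t n 0)) * norm (ghat F (t n) k y - ghat F (t n) k z)"
      using ghat_bilipschitz[of n F "t n" L k] F_C2s F_lip t_range step_pos h L0 n k
      by (simp_all add: less_imp_le)
    have "exp (2 * L * (t n k - t n 0)) \<le> E"
      unfolding E_def using n k t_start[of n] t_range[of n k] L0 by (simp add: mult_left_mono)
    then have exp: "norm (y - z) \<le> E * norm (ghat F (t n) k y - ghat F (t n) k z)" for y z
      by (rule order_trans[OF g(3) mult_right_mono]) simp
    have "C2_diffeomorphism (ghat F (t n) k)"
      by (rule C2_diffeomorphismI[OF g(1,2) _ exp]) (simp add: E_def)
    moreover have "norm (ghat_inv F (t n) k y - ghat_inv F (t n) k z) \<le> E * norm (y - z)" for y z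
      using exp[of "ghat_inv F (t n) k y" "ghat_inv F (t n) k z"] by (simp add: surj_f_inv_f[OF g(2)])
    ultimately show ?thesis by blast
  qed

  have main: "\<forall>\<^sub>F n in sequentially.
      (\<forall>k\<le>n. C2_diffeomorphism (ghat F (t n) k)) \<and>
      markov_chain (M n) n (\<lambda>k \<omega>. ghat_inv F (t n) k (X n k \<omega>)) \<and>
      (\<forall>k<n. \<forall>\<omega>\<in>space (M n).
         ghat_inv F (t n) (Suc k) (X n (Suc k) \<omega>) =
           ghat_inv F (t n) k (X n k \<omega>)
           + step (t n) k *\<^sub>R
               m_tilde F m \<sigma> (t n) k (ghat_inv F (t n) k (X n k \<omega>)) (\<epsilon> n (Suc k) \<omega>)
           + sqrt (step (t n) k) *\<^sub>R
               (sigma_tilde F m \<sigma> (t n) k (ghat_inv F (t n) k (X n k \<omega>)) (\<epsilon> n (Suc k) \<omega>)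
                *v \<epsilon> n (Suc k) \<omega>))"
    using small
  proof eventually_elim
    case (elim n)
    then have n: "n \<ge> 1" by simp
    have diffeo: "C2_diffeomorphism (ghat F (t n) k)" if "k \<le> n" for k
      using ghat elim that by blast
    have bij: "bij (ghat F (t n) k)" and C2: "C2_on UNIV (ghat F (t n) k)"
      and C2_inv: "C2_on UNIV (ghat_inv F (t n) k)" if "k \<le> n" for k
      using diffeo[OF that] by (auto simp: C2_diffeomorphism_def)
    have g_inv: "ghat F (t n) k (ghat_inv F (t n) k y) = y" if "k \<le> n" for k y
      using bij[OF that] by (simp add: bij_is_surj surj_f_inv_f)
    \<comment> \<open>The transition in the new coordinates: go forward with the flow at time k,
      make one step of the original chain with noise e, and go back with the inverse flow at time k
      + 1.\<close>
    let ?G = "\<lambda>k (y, e). ghat_inv F (t n) (Suc k) (ghat F (t n) k y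
        + step (t n) k *\<^sub>R (F (t n k) (ghat F (t n) k y) + m (t n k) (ghat F (t n) k y))
        + sqrt (step (t n) k) *\<^sub>R (\<sigma> (t n k) (ghat F (t n) k y) *v e))"
    have X_rec: "ghat_inv F (t n) (Suc k) (X n (Suc k) \<omega>)
        = ?G k (ghat_inv F (t n) k (X n k \<omega>), \<epsilon> n (Suc k) \<omega>)" if "k < n" "\<omega> \<in> space (M n)" for k \<omega>
      using that by (simp add: X_step[OF n that] g_inv)
    interpret prob_space "M n" by (rule prob[OF n])
    have "markov_chain (M n) n (\<lambda>k \<omega>. ghat_inv F (t n) k (X n k \<omega>))"
    proof (rule markov_chain_recursion[OF innovations[OF n], where G = ?G])
      show "ghat_inv F (t n) 0 (X n 0 \<omega>) = ghat_inv F (t n) 0 x" if "\<omega> \<in> space (M n)" for \<omega>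
        by (simp add: X_start[OF n that])
      show "ghat_inv F (t n) (Suc k) (X n (Suc k) \<omega>)
        = ?G k (ghat_inv F (t n) k (X n k \<omega>), \<epsilon> n (Suc k) \<omega>)" if "k < n" "\<omega> \<in> space (M n)" for k \<omega>
        by (rule X_rec[OF that])
      fix k assume k: "k < n"
      have s: "t n k \<in> {0..T}" using t_range n k by simp
      have cont_borel: "f \<in> borel_measurable borel"
        if "C2_on UNIV f" for f :: "real ^ 'd \<Rightarrow> real ^ 'd"
        using C2_onE[OF that] borel_measurable_continuous_onI by metis
      have [measurable]: "ghat F (t n) k \<in> borel_measurable borel"
          "ghat_inv F (t n) (Suc k) \<in> borel_measurable borel" "F (t n k) \<in> borel_measurable borel"
        using cont_borel C2 C2_inv F_C2s[OF s] k by simp_all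
      have "continuous_on UNIV (\<lambda>y. (t n k, y))"
        by (intro continuous_intros)
      from continuous_on_compose2[OF m_cont this] have "continuous_on UNIV (m (t n k))"
        using s by (simp add: image_subset_iff)
      then have [measurable]: "m (t n k) \<in> borel_measurable borel"
        by (rule borel_measurable_continuous_onI)
      have [measurable]: "\<sigma> (t n k) \<in> borel_measurable borel"
        by (rule sigma_measurable[OF s])
      show "?G k \<in> borel_measurable (borel \<Otimes>\<^sub>M borel)"
        by measurable
    qed
    moreover have "ghat_inv F (t n) (Suc k) (X n (Suc k) \<omega>) =
           ghat_inv F (t n) k (X n k \<omega>)
           + step (t n) k *\<^sub>R
               m_tilde F m \<sigma> (t n) k (ghat_inv F (t n) k (X n k \<omega>)) (\<epsilon> n (Suc k) \<omega>)
           + sqrt (step (t n) k) *\<^sub>R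
               (sigma_tilde F m \<sigma> (t n) k (ghat_inv F (t n) k (X n k \<omega>)) (\<epsilon> n (Suc k) \<omega>)
                *v \<epsilon> n (Suc k) \<omega>)" if "k < n" "\<omega> \<in> space (M n)" for k \<omega>
      unfolding X_rec[OF that] prod.case
      using that by (intro tilde_increment C2_inv bij_is_inj bij) auto
    ultimately show ?case using diffeo by blast
  qed

  \<comment> \<open>\<open>K\<close> bounds the integrated Jacobians and \<open>S\<close> bounds
    \<open>\<sigma>\<close>, both independently of n and k. \<open>Kv\<close> and \<open>Km\<close>
    below are the continuity constants of the matrix products, and the maximum of the two resulting
    bounds serves as \<open>C'\<close>.\<close>
  define K where "K = (real CARD('d))\<^sup>2 * E"
  define S where "S = real CARD('d) * sqrt \<Lambda>"
  have \<sigma>_bound: "norm (\<sigma> s y) \<le> S" if "s \<in> {0..T}" for s y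
    unfolding S_def by (rule norm_le_of_elliptic[OF \<Lambda>[OF that]])
  obtain Kv where Kv: "0 \<le> Kv" "\<And>(A :: real ^ 'd ^ 'd) (v :: real ^ 'd). norm (A *v v) \<le> norm A * norm v * Kv"
    using bounded_bilinear.nonneg_bounded[OF bounded_bilinear_matrix_vector_mult] by blast
  obtain Km where Km: "0 \<le> Km" "\<And>(A :: real ^ 'd ^ 'd) (B :: real ^ 'd ^ 'd). norm (A ** B) \<le> norm A * norm B * Km"
    using bounded_bilinear.nonneg_bounded[OF bounded_bilinear_matrix_matrix_mult] by blast
  have K0: "0 \<le> K" by (simp add: K_def E_def)
  have "\<forall>\<^sub>F n in sequentially. \<forall>k<n. \<forall>y e.
      norm (m_tilde F m \<sigma> (t n) k y e) \<le> max (K * M_m * Kv) (K * S * Km) \<and>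
      norm (sigma_tilde F m \<sigma> (t n) k y e) \<le> max (K * M_m * Kv) (K * S * Km)"
    using small
  proof eventually_elim
    case (elim n)
    have "norm (m_tilde F m \<sigma> (t n) k y e) \<le> K * M_m * Kv \<and>
        norm (sigma_tilde F m \<sigma> (t n) k y e) \<le> K * S * Km" if k: "k < n" for k y e
    proof -
      let ?I = "integral {0..1} (\<lambda>u. ghat_inv_jac F (t n) (Suc k) (Psi F m \<sigma> (t n) k u y e))"
      have s: "t n k \<in> {0..T}" using t_range elim k by simp
      have g: "C2_diffeomorphism (ghat F (t n) (Suc k)) \<and>
          (\<forall>y z. norm (ghat_inv F (t n) (Suc k) y - ghat_inv F (t n) (Suc k) z) \<le> E * norm (y - z))"
        using ghat elim k by (metis Suc_leI)
      have I: "norm ?I \<le> K"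
        unfolding K_def using g by (intro norm_ghat_inv_jac_integral_le) (auto simp: C2_diffeomorphism_def)
      have "norm (m_tilde F m \<sigma> (t n) k y e) \<le> K * M_m * Kv"
        unfolding m_tilde_def
        by (rule order_trans[OF Kv(2)]) (intro mult_right_mono mult_mono I M_m s K0 Kv(1) norm_ge_zero)
      moreover have "norm (sigma_tilde F m \<sigma> (t n) k y e) \<le> K * S * Km"
        unfolding sigma_tilde_def
        by (rule order_trans[OF Km(2)]) (intro mult_right_mono mult_mono I \<sigma>_bound s K0 Km(1) norm_ge_zero)
      ultimately show ?thesis by blast
    qed
    then show ?case by (auto intro: max.coboundedI1 max.coboundedI2)
  qed
  with main show ?thesis by blast
qed

end
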